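(* Let $X$ be a regular diffusion on $I=[0,1]$ with generator $A=\frac12 b(x)\frac{d^2}{dx^2}+a(x)\frac{d}{dx}$, and assume that $X$ has instantaneously reflecting boundaries at $0$ and at $1$. Assume further that $b\in C^1(I^\circ)$. If $X^*$ is a strong stationary dual of $X$, then the generator $A^*$ of $X^*$ has the form $$(A^*f)(x)=\left(\frac12 b'(x)-a(x)+b(x)\frac{\pi(x)}{\Pi(x)}\right)f'(x)+\frac12 b(x)f''(x)$$ for $x\in I^\circ$ and $f\in\mathcal{D}_{A^*}$. Moreover, $0$ is an entrance boundary for $X^*$ and $1$ is a regular absorbing boundary of $X^*$.
   Context: Diffusions. $I=[0,1]$, $I^\circ=(0,1)$; $a,b\in C(I^\circ)$ with $b>0$ on $I^\circ$. $X$ is a time-homogeneous Feller diffusion on $I$ with initial distribution $\Pi_0$ and generator $A=\frac12 b\frac{d^2}{dx^2}+a\frac{d}{dx}$ with domain $\mathcal{D}_A\subset\{f\in C(I)\cap C^2(I^\circ): Af\in C(I)\}$. Regular means $\mathbb{P}(T_y<\infty\mid X_0=x)>0$ for all $x,y\in I^\circ$, where $T_y$ is the hitting time of $y$. A scale function $S$ is defined by $S'(x)=s(x)=\exp\{-\int^x \frac{2a(y)}{b(y)}dy\}$; the speed measure $M(dx)$ on $I^\circ$ has density $m(x)=1/(s(x)b(x))$, and $M(\cdot)$ also denotes the speed function. Expressions at boundary points are interpreted as limits. Boundary classification. With $x\in I^\circ$ fixed, at $0$ put $N(0)=\int_{(0,x]}[S(x)-S(\eta)]M(d\eta)$, $\Sigma(0)=\int_{(0,x]}[M(x)-M(\eta)]dS(\eta)$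 (analogously, $N(1)=\int_{[x,1)}[S(\eta)-S(x)]M(d\eta)$, $\Sigma(1)=\int_{[x,1)}[M(\eta)-M(x)]dS(\eta)$). A boundary is entrance if $N<\infty,\Sigma=\infty$; exit if $N=\infty,\Sigma<\infty$; natural if $N=\Sigma=\infty$; regular if $N<\infty,\Sigma<\infty$. For a diffusion with generator $A$, a regular boundary $0$ is instantaneously reflecting if $f\in\mathcal{D}_A$ implies $\frac{df}{dS}^+(0)=\lim_{x\downarrow0}\frac{f'(x)}{s(x)}=0$, and a boundary is absorbing if $f\in\mathcal{D}_A$ implies $Af=0$ there (similarly at $1$). With both boundaries instantaneously reflecting, $\mathcal{D}_A=\{f\in C(I)\cap C^2(I^\circ): Af\in C(I),\ \frac{df}{dS}^+(0)=\frac{df}{dS}^-(1)=0\}$. $M$ is then a finite measure; its normalization to a probability measure is the unique invariant distribution $\Pi(dx)$, with density $\pi>0$ on $I^\circ$, and $\Pi(x)=\int_0^x\pi(y)\,dy$. Strong stationary dual. Let $\mathcal{F}[0,1]$ be the bounded measurable real functions on $[0,1]$, and for a measure $\mu$ write $(\mu,f)=\int f\,d\mu$. For $f\in\mathcal{F}[0,1]$ let $(\Lambda f)(x)=\int_0^x\frac{\pi(y)}{\Pi(x)}f(y)\,dy$ for $x>0$ and $(\Lambda f)(0)=f(0)$. Let $X^*$ be a second Feller diffusion on $I$ with initial distribution $\Pi_0^*$ and generator $A^*$ (of the form $\frac12 b^*\frac{d^2}{dx^2}+a^*\frac{d}{dx}$ on $I^\circ$ with $a^*,b^*\in C(I^\circ)$,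 $b^*>0$) with domain $\mathcal{D}_{A^*}$. $X^*$ is a strong stationary dual of $X$ if (i) $\Lambda$ maps $\mathcal{D}_A$ into $\mathcal{D}_{A^*}$; (ii) $\Lambda A=A^*\Lambda$ as operators on $\mathcal{D}_A$; (iii) $(\Pi_0,f)=(\Pi_0^*,\Lambda f)$ for all $f\in\mathcal{F}[0,1]$. *)

theory Defs
  imports "HOL-Probability.Probability"
begin

section \<open>Feller diffusions on the unit interval\<close>

definition unit_borel :: "real measure" where
  "unit_borel = restrict_space borel {0..1}"

text \<open>
  A diffusion is given as a Markov family: one process \<open>coord t\<close> on a measurable space of
  outcomes, the laws \<open>law x\<close> of the process started at \<open>x\<close>, which give the meaning of
  conditioning on \<open>X\<^sub>0 = x\<close>, and an initial distribution.
\<close>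

record 'w diffusion =
  outcomes :: "'w measure"
  coord :: "real \<Rightarrow> 'w \<Rightarrow> real"
  law :: "real \<Rightarrow> 'w measure"
  initial :: "real measure"

definition bounded_measurable :: "(real \<Rightarrow> real) set" where
  "bounded_measurable = {f. f \<in> borel_measurable unit_borel \<and> bounded (f ` {0..1})}"

definition natural_filtration :: "'w diffusion \<Rightarrow> real \<Rightarrow> 'w measure" where
  "natural_filtration X s =
     sigma (space (outcomes X))
       {coord X u -` B \<inter> space (outcomes X) | u B. u \<in> {0..s} \<and> B \<in> sets borel}"

definition transition :: "'w diffusion \<Rightarrow> real \<Rightarrow> (real \<Rightarrow> real) \<Rightarrow> real \<Rightarrow> real" where
  "transition X t f x = (\<integral>\<omega>. f (coord X t \<omega>) \<partial>law X x)"

definition markov_property :: "'w diffusion \<Rightarrow> bool" where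
  "markov_property X \<longleftrightarrow>
     (\<forall>x\<in>{0..1}. \<forall>s\<ge>0. \<forall>t\<ge>0. \<forall>f\<in>bounded_measurable.
        AE \<omega> in law X x.
          real_cond_exp (law X x) (natural_filtration X s) (\<lambda>\<omega>. f (coord X (s + t) \<omega>)) \<omega>
            = transition X t f (coord X s \<omega>))"

text \<open>The semigroup maps \<open>C[0,1]\<close> into itself and is strongly continuous there.\<close>

definition feller_property :: "'w diffusion \<Rightarrow> bool" where
  "feller_property X \<longleftrightarrow>
     (\<forall>f. continuous_on {0..1} f \<longrightarrow>
        (\<forall>t\<ge>0. continuous_on {0..1} (transition X t f)) \<and>
        uniform_limit {0..1} (\<lambda>t. transition X t f) f (at_right 0))"

definition feller_diffusion :: "'w diffusion \<Rightarrow> bool" where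
  "feller_diffusion X \<longleftrightarrow>
     law X \<in> unit_borel \<rightarrow>\<^sub>M prob_algebra (outcomes X) \<and>
     initial X \<in> space (prob_algebra unit_borel) \<and>
     (\<forall>t\<ge>0. coord X t \<in> outcomes X \<rightarrow>\<^sub>M unit_borel) \<and>
     (\<forall>\<omega>\<in>space (outcomes X). continuous_on {0..} (\<lambda>t. coord X t \<omega>)) \<and>
     (\<forall>x\<in>{0..1}. AE \<omega> in law X x. coord X 0 \<omega> = x) \<and>
     markov_property X \<and>
     feller_property X"

definition hitting_time :: "'w diffusion \<Rightarrow> real \<Rightarrow> 'w \<Rightarrow> ereal" where
  "hitting_time X y \<omega> = Inf (ereal ` {t. t \<ge> 0 \<and> coord X t \<omega> = y})"

definition regular_diffusion :: "'w diffusion \<Rightarrow> bool" where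
  "regular_diffusion X \<longleftrightarrow>
     (\<forall>x\<in>{0<..<1}. \<forall>y\<in>{0<..<1}.
        measure (law X x) {\<omega> \<in> space (law X x). hitting_time X y \<omega> < \<infinity>} > 0)"

section \<open>Generators\<close>

text \<open>
  Elements of \<open>C[0,1]\<close> are represented by functions on the reals of which only the values on
  \<open>[0,1]\<close> matter. Convergence of the difference quotients is in the norm of \<open>C[0,1]\<close>.
\<close>

definition generator_domain :: "'w diffusion \<Rightarrow> (real \<Rightarrow> real) set" where
  "generator_domain X =
     {f. continuous_on {0..1} f \<and>
         (\<exists>g. continuous_on {0..1} g \<and>
              uniform_limit {0..1} (\<lambda>t x. (transition X t f x - f x) / t) g (at_right 0))}"

definition generator :: "'w diffusion \<Rightarrow> (real \<Rightarrow> real) \<Rightarrow> real \<Rightarrow> real" where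
  "generator X f x = Lim (at_right 0) (\<lambda>t. (transition X t f x - f x) / t)"

text \<open>
  Continuity of \<open>generator X f\<close> on \<open>[0,1]\<close> is already part of \<open>f \<in> generator_domain X\<close>.
\<close>

definition diffusion_with_coefficients ::
    "(real \<Rightarrow> real) \<Rightarrow> (real \<Rightarrow> real) \<Rightarrow> 'w diffusion \<Rightarrow> bool" where
  "diffusion_with_coefficients a b X \<longleftrightarrow>
     feller_diffusion X \<and>
     continuous_on {0<..<1} a \<and> continuous_on {0<..<1} b \<and> (\<forall>x\<in>{0<..<1}. b x > 0) \<and>
     (\<forall>f\<in>generator_domain X.
        f C1_differentiable_on {0<..<1} \<and> deriv f C1_differentiable_on {0<..<1} \<and>
        (\<forall>x\<in>{0<..<1}. generator X f x = 1/2 * b x * deriv (deriv f) x + a x * deriv f x))"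

section \<open>Scale, speed and boundary classification\<close>

text \<open>
  The interior point \<open>c\<close> serves both as the lower limit of the indefinite integrals and as the
  fixed interior point of the boundary classification.
\<close>

definition scale_density :: "real \<Rightarrow> (real \<Rightarrow> real) \<Rightarrow> (real \<Rightarrow> real) \<Rightarrow> real \<Rightarrow> real" where
  "scale_density c a b x = exp (- (LBINT y=c..x. 2 * a y / b y))"

definition speed_density :: "real \<Rightarrow> (real \<Rightarrow> real) \<Rightarrow> (real \<Rightarrow> real) \<Rightarrow> real \<Rightarrow> real" where
  "speed_density c a b x = 1 / (scale_density c a b x * b x)"

definition scale_fun :: "real \<Rightarrow> (real \<Rightarrow> real) \<Rightarrow> (real \<Rightarrow> real) \<Rightarrow> real \<Rightarrow> real" where
  "scale_fun c a b x = (LBINT y=c..x. scale_density c a b y)"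

definition speed_fun :: "real \<Rightarrow> (real \<Rightarrow> real) \<Rightarrow> (real \<Rightarrow> real) \<Rightarrow> real \<Rightarrow> real" where
  "speed_fun c a b x = (LBINT y=c..x. speed_density c a b y)"

definition scale_measure :: "real \<Rightarrow> (real \<Rightarrow> real) \<Rightarrow> (real \<Rightarrow> real) \<Rightarrow> real measure" where
  "scale_measure c a b =
     density lborel (\<lambda>x. indicator {0<..<1} x * ennreal (scale_density c a b x))"

definition speed_measure :: "real \<Rightarrow> (real \<Rightarrow> real) \<Rightarrow> (real \<Rightarrow> real) \<Rightarrow> real measure" where
  "speed_measure c a b =
     density lborel (\<lambda>x. indicator {0<..<1} x * ennreal (speed_density c a b x))"

definition N0 :: "real \<Rightarrow> (real \<Rightarrow> real) \<Rightarrow> (real \<Rightarrow> real) \<Rightarrow> ennreal" where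
  "N0 c a b =
     (\<integral>\<^sup>+\<eta>\<in>{0<..c}. ennreal (scale_fun c a b c - scale_fun c a b \<eta>) \<partial>speed_measure c a b)"

definition Sigma0 :: "real \<Rightarrow> (real \<Rightarrow> real) \<Rightarrow> (real \<Rightarrow> real) \<Rightarrow> ennreal" where
  "Sigma0 c a b =
     (\<integral>\<^sup>+\<eta>\<in>{0<..c}. ennreal (speed_fun c a b c - speed_fun c a b \<eta>) \<partial>scale_measure c a b)"

definition N1 :: "real \<Rightarrow> (real \<Rightarrow> real) \<Rightarrow> (real \<Rightarrow> real) \<Rightarrow> ennreal" where
  "N1 c a b =
     (\<integral>\<^sup>+\<eta>\<in>{c..<1}. ennreal (scale_fun c a b \<eta> - scale_fun c a b c) \<partial>speed_measure c a b)"

definition Sigma1 :: "real \<Rightarrow> (real \<Rightarrow> real) \<Rightarrow> (real \<Rightarrow> real) \<Rightarrow> ennreal" where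
  "Sigma1 c a b =
     (\<integral>\<^sup>+\<eta>\<in>{c..<1}. ennreal (speed_fun c a b \<eta> - speed_fun c a b c) \<partial>scale_measure c a b)"

definition entrance_at_0 :: "real \<Rightarrow> (real \<Rightarrow> real) \<Rightarrow> (real \<Rightarrow> real) \<Rightarrow> bool" where
  "entrance_at_0 c a b \<longleftrightarrow> N0 c a b < \<infinity> \<and> Sigma0 c a b = \<infinity>"

definition regular_at_0 :: "real \<Rightarrow> (real \<Rightarrow> real) \<Rightarrow> (real \<Rightarrow> real) \<Rightarrow> bool" where
  "regular_at_0 c a b \<longleftrightarrow> N0 c a b < \<infinity> \<and> Sigma0 c a b < \<infinity>"

definition regular_at_1 :: "real \<Rightarrow> (real \<Rightarrow> real) \<Rightarrow> (real \<Rightarrow> real) \<Rightarrow> bool" where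
  "regular_at_1 c a b \<longleftrightarrow> N1 c a b < \<infinity> \<and> Sigma1 c a b < \<infinity>"

definition reflecting_at_0 ::
    "real \<Rightarrow> (real \<Rightarrow> real) \<Rightarrow> (real \<Rightarrow> real) \<Rightarrow> 'w diffusion \<Rightarrow> bool" where
  "reflecting_at_0 c a b X \<longleftrightarrow>
     regular_at_0 c a b \<and>
     (\<forall>f\<in>generator_domain X. ((\<lambda>x. deriv f x / scale_density c a b x) \<longlongrightarrow> 0) (at_right 0))"

definition reflecting_at_1 ::
    "real \<Rightarrow> (real \<Rightarrow> real) \<Rightarrow> (real \<Rightarrow> real) \<Rightarrow> 'w diffusion \<Rightarrow> bool" where
  "reflecting_at_1 c a b X \<longleftrightarrow>
     regular_at_1 c a b \<and>
     (\<forall>f\<in>generator_domain X. ((\<lambda>x. deriv f x / scale_density c a b x) \<longlongrightarrow> 0) (at_left 1))"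

definition absorbing_at :: "real \<Rightarrow> 'w diffusion \<Rightarrow> bool" where
  "absorbing_at e X \<longleftrightarrow> (\<forall>f\<in>generator_domain X. generator X f e = 0)"

section \<open>Strong stationary duals\<close>

text \<open>
  The invariant distribution is the speed measure normalized to a probability measure;
  \<open>stat_density\<close> and \<open>stat_cdf\<close> do not depend on \<open>c\<close>.
\<close>

definition stat_density :: "real \<Rightarrow> (real \<Rightarrow> real) \<Rightarrow> (real \<Rightarrow> real) \<Rightarrow> real \<Rightarrow> real" where
  "stat_density c a b x = speed_density c a b x / measure (speed_measure c a b) {0<..<1}"

definition stat_cdf :: "real \<Rightarrow> (real \<Rightarrow> real) \<Rightarrow> (real \<Rightarrow> real) \<Rightarrow> real \<Rightarrow> real" where
  "stat_cdf c a b x = (LBINT y=0..x. stat_density c a b y)"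

definition link :: "real \<Rightarrow> (real \<Rightarrow> real) \<Rightarrow> (real \<Rightarrow> real) \<Rightarrow> (real \<Rightarrow> real) \<Rightarrow> real \<Rightarrow> real" where
  "link c a b f x =
     (if x = 0 then f 0 else (LBINT y=0..x. stat_density c a b y / stat_cdf c a b x * f y))"

definition strong_stationary_dual ::
    "real \<Rightarrow> (real \<Rightarrow> real) \<Rightarrow> (real \<Rightarrow> real) \<Rightarrow> 'w diffusion \<Rightarrow>
      (real \<Rightarrow> real) \<Rightarrow> (real \<Rightarrow> real) \<Rightarrow> 'v diffusion \<Rightarrow> bool" where
  "strong_stationary_dual c a b X a' b' X' \<longleftrightarrow>
     diffusion_with_coefficients a' b' X' \<and>
     (\<forall>f\<in>generator_domain X. link c a b f \<in> generator_domain X') \<and>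
     (\<forall>f\<in>generator_domain X. \<forall>x\<in>{0..1}.
        link c a b (generator X f) x = generator X' (link c a b f) x) \<and>
     (\<forall>f\<in>bounded_measurable.
        (\<integral>x. f x \<partial>initial X) = (\<integral>x. link c a b f x \<partial>initial X'))"

end

theory Submission
  imports Defs
begin

text \<open>
  Write \<open>r = \<pi> / \<Pi>\<close>. On \<open>(0,1)\<close> one has \<open>(\<Lambda> f)' = r (f - \<Lambda> f)\<close>, and, as \<open>2 m A f = (f' / s)'\<close> and the
  flux \<open>f' / s\<close> vanishes at \<open>0\<close>, also \<open>\<Lambda> A f = b r f' / 2\<close>. Hence \<open>\<Lambda> A = A\<^sup>* \<Lambda>\<close> is a linear relation
  between \<open>f'\<close> and \<open>f - \<Lambda> f\<close> with coefficients depending only on the data. The domain of a Feller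
  generator is dense in \<open>C[0,1]\<close>, which forces both coefficients of this relation to vanish and so
  determines \<open>a\<^sup>*\<close> and \<open>b\<^sup>*\<close>. The dual scale density is then a multiple of \<open>m / \<Pi>\<^sup>2\<close>, the dual scale
  function an affine function of \<open>1 / \<Pi>\<close> and the dual speed density a multiple of \<open>s \<Pi>\<^sup>2\<close>, from which
  the types of the boundaries are read off. Absorption at \<open>1\<close> holds on the range of \<open>\<Lambda>\<close>, because
  the flux vanishes at \<open>1\<close> as well, and extends to the whole domain by the positive maximum principle.
\<close>

section \<open>The semigroup of a Feller diffusion\<close>

lemma continuous_on_bounded_measurable:
  assumes "continuous_on {0..1} f"
  shows "f \<in> bounded_measurable"
  using assms compact_imp_bounded[OF compact_continuous_image[OF assms compact_Icc]]
  by (simp add: bounded_measurable_def unit_borel_def borel_measurable_continuous_on_restrict)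

lemma continuous_on_Icc_bound:
  fixes f :: "real \<Rightarrow> real"
  assumes "continuous_on {0..1} f"
  obtains K where "\<And>x. x \<in> {0..1} \<Longrightarrow> \<bar>f x\<bar> \<le> K"
  using compact_imp_bounded[OF compact_continuous_image[OF assms compact_Icc]]
  by (metis bounded_iff image_eqI real_norm_def)

locale feller =
  fixes X :: "'w diffusion"
  assumes feller: "feller_diffusion X"
begin

section \<open>Laws, coordinates and elementary bounds for the transition operators\<close>

lemma law_props:
  assumes "x \<in> {0..1}"
  shows prob_space_law: "prob_space (law X x)"
    and sets_law: "sets (law X x) = sets (outcomes X)"
proof -
  have "law X \<in> unit_borel \<rightarrow>\<^sub>M prob_algebra (outcomes X)"
    using feller by (simp add: feller_diffusion_def)
  moreover have "x \<in> space unit_borel"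
    using assms by (simp add: unit_borel_def space_restrict_space)
  ultimately have "law X x \<in> space (prob_algebra (outcomes X))"
    by (rule measurable_space)
  then show "prob_space (law X x)" "sets (law X x) = sets (outcomes X)"
    by (auto simp: space_prob_algebra)
qed

lemma space_law: "x \<in> {0..1} \<Longrightarrow> space (law X x) = space (outcomes X)"
  by (rule sets_eq_imp_space_eq[OF sets_law])

lemma coord_measurable_outcomes: "t \<ge> 0 \<Longrightarrow> coord X t \<in> outcomes X \<rightarrow>\<^sub>M unit_borel"
  using feller by (simp add: feller_diffusion_def)

lemma coord_measurable:
  assumes "t \<ge> 0" "x \<in> {0..1}"
  shows "coord X t \<in> law X x \<rightarrow>\<^sub>M unit_borel"
  using coord_measurable_outcomes[OF assms(1)] sets_law[OF assms(2)] by (simp cong: measurable_cong_sets)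

lemma coord_in:
  assumes "t \<ge> 0" "x \<in> {0..1}" "\<omega> \<in> space (law X x)"
  shows "coord X t \<omega> \<in> {0..1}"
  using measurable_space[OF coord_measurable[OF assms(1,2)] assms(3)]
  by (simp add: unit_borel_def space_restrict_space)

lemma integrable_coord:
  assumes "t \<ge> 0" "x \<in> {0..1}" "f \<in> bounded_measurable"
  shows "integrable (law X x) (\<lambda>\<omega>. f (coord X t \<omega>))"
proof -
  interpret prob_space "law X x" by (rule prob_space_law[OF assms(2)])
  obtain K where K: "\<And>y. y \<in> {0..1} \<Longrightarrow> norm (f y) \<le> K"
    using assms(3) unfolding bounded_measurable_def bounded_iff by blast
  show ?thesis
  proof (rule integrable_const_bound[where B = K])
    show "AE \<omega> in law X x. norm (f (coord X t \<omega>)) \<le> K"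
      using coord_in[OF assms(1,2)] K by (intro AE_I2) blast
    show "(\<lambda>\<omega>. f (coord X t \<omega>)) \<in> borel_measurable (law X x)"
      using measurable_compose[OF coord_measurable[OF assms(1,2)], of f borel] assms(3)
      by (simp add: bounded_measurable_def)
  qed
qed

lemma transition_add_scaled:
  assumes "t \<ge> 0" "x \<in> {0..1}" "f \<in> bounded_measurable" "g \<in> bounded_measurable"
  shows "transition X t (\<lambda>y. u * f y + v * g y) x = u * transition X t f x + v * transition X t g x"
  using integrable_coord[OF assms(1,2,3)] integrable_coord[OF assms(1,2,4)]
  by (simp add: transition_def)

lemma transition_le:
  assumes "t \<ge> 0" "x \<in> {0..1}" "f \<in> bounded_measurable" "\<And>y. y \<in> {0..1} \<Longrightarrow> f y \<le> K"
  shows "transition X t f x \<le> K"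
proof -
  interpret prob_space "law X x" by (rule prob_space_law[OF assms(2)])
  show ?thesis
    unfolding transition_def
    by (rule integral_le_const[OF integrable_coord[OF assms(1-3)]])
      (use coord_in[OF assms(1,2)] assms(4) in \<open>auto intro!: AE_I2\<close>)
qed

lemma abs_transition_diff_le:
  assumes "t \<ge> 0" "x \<in> {0..1}" "f \<in> bounded_measurable" "g \<in> bounded_measurable"
    and "\<And>y. y \<in> {0..1} \<Longrightarrow> \<bar>f y - g y\<bar> \<le> K"
  shows "\<bar>transition X t f x - transition X t g x\<bar> \<le> K"
proof -
  interpret prob_space "law X x" by (rule prob_space_law[OF assms(2)])
  note int = integrable_coord[OF assms(1,2,3)] integrable_coord[OF assms(1,2,4)]
  have "\<bar>\<integral>\<omega>. f (coord X t \<omega>) - g (coord X t \<omega>) \<partial>law X x\<bar>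
      \<le> (\<integral>\<omega>. \<bar>f (coord X t \<omega>) - g (coord X t \<omega>)\<bar> \<partial>law X x)"
    by (rule integral_abs_bound)
  also have "\<dots> \<le> K"
    by (rule integral_le_const)
      (use int coord_in[OF assms(1,2)] assms(5) in \<open>auto intro!: AE_I2\<close>)
  finally show ?thesis
    using int by (simp add: transition_def)
qed

lemma transition_0:
  assumes "x \<in> {0..1}" "f \<in> bounded_measurable"
  shows "transition X 0 f x = f x"
proof -
  interpret prob_space "law X x" by (rule prob_space_law[OF assms(1)])
  have "AE \<omega> in law X x. coord X 0 \<omega> = x"
    using feller assms(1) by (simp add: feller_diffusion_def)
  then have "transition X 0 f x = (\<integral>\<omega>. f x \<partial>law X x)"
    unfolding transition_def
    using borel_measurable_integrable[OF integrable_coord[OF order.refl assms]]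
    by (intro integral_cong_AE) auto
  then show ?thesis by (simp add: prob_space)
qed

section \<open>Semigroup identity and continuity in time and starting point\<close>

lemma subalgebra_natural_filtration:
  assumes "s \<ge> 0" "x \<in> {0..1}"
  shows "subalgebra (law X x) (natural_filtration X s)"
proof -
  let ?G = "{coord X u -` B \<inter> space (outcomes X) | u B. u \<in> {0..s} \<and> B \<in> sets borel}"
  have "coord X u -` B \<inter> space (outcomes X) \<in> sets (outcomes X)"
    if "u \<in> {0..s}" "B \<in> sets borel" for u B
  proof -
    have "coord X u \<in> outcomes X \<rightarrow>\<^sub>M borel"
      using coord_measurable_outcomes[of u] that(1)
      by (simp add: unit_borel_def measurable_restrict_space2_iff)
    then show ?thesis using that(2) by (rule measurable_sets)
  qed
  then have "?G \<subseteq> sets (outcomes X)" by auto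
  moreover from this have "?G \<subseteq> Pow (space (outcomes X))"
    using sets.sets_into_space by blast
  ultimately show ?thesis
    unfolding subalgebra_def natural_filtration_def space_law[OF assms(2)] sets_law[OF assms(2)]
    by (simp add: sets_measure_of sets.sigma_sets_subset)
qed

lemma continuous_transition:
  "continuous_on {0..1} f \<Longrightarrow> t \<ge> 0 \<Longrightarrow> continuous_on {0..1} (transition X t f)"
  using feller by (simp add: feller_diffusion_def feller_property_def)

text \<open>Chapman-Kolmogorov identity: a conditional expectation has the same mean as the
  conditioned variable, so integrating the Markov property removes the conditioning.\<close>

lemma transition_add:
  assumes "s \<ge> 0" "t \<ge> 0" "x \<in> {0..1}" "continuous_on {0..1} f"
  shows "transition X (s + t) f x = transition X s (transition X t f) x"
proof -
  interpret prob_space "law X x" by (rule prob_space_law[OF assms(3)])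
  interpret finite_measure_subalgebra "law X x" "natural_filtration X s"
    by unfold_locales (rule subalgebra_natural_filtration[OF assms(1,3)])
  have fb: "f \<in> bounded_measurable" and tb: "transition X t f \<in> bounded_measurable"
    using assms by (auto intro!: continuous_on_bounded_measurable continuous_transition)
  have int: "integrable (law X x) (\<lambda>\<omega>. f (coord X (s + t) \<omega>))"
    using assms(1,2) by (intro integrable_coord assms fb) simp
  have "AE \<omega> in law X x.
      real_cond_exp (law X x) (natural_filtration X s) (\<lambda>\<omega>. f (coord X (s + t) \<omega>)) \<omega>
        = transition X t f (coord X s \<omega>)"
    using feller assms(1-3) fb by (simp add: feller_diffusion_def markov_property_def)
  then have "(\<integral>\<omega>. real_cond_exp (law X x) (natural_filtration X s) (\<lambda>\<omega>. f (coord X (s + t) \<omega>)) \<omega> \<partial>law X x)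
      = (\<integral>\<omega>. transition X t f (coord X s \<omega>) \<partial>law X x)"
    using borel_measurable_integrable[OF real_cond_exp_int(1)[OF int]]
      borel_measurable_integrable[OF integrable_coord[OF assms(1,3) tb]]
    by (intro integral_cong_AE) auto
  then show ?thesis
    using real_cond_exp_int(2)[OF int] by (simp add: transition_def)
qed

text \<open>For \<open>s \<le> t\<close> the difference is \<open>transition X s\<close> applied to
  \<open>f - transition X (t - s) f\<close>, and transition operators are contractions. So strong
  continuity at time 0 gives a modulus uniform in both time and starting point.\<close>

lemma transition_small_time:
  assumes "continuous_on {0..1} f" "\<epsilon> > 0"
  obtains \<delta> where "\<delta> > 0"
    "\<And>s t x. \<lbrakk>0 \<le> s; 0 \<le> t; \<bar>s - t\<bar> < \<delta>; x \<in> {0..1}\<rbrakk>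
        \<Longrightarrow> \<bar>transition X s f x - transition X t f x\<bar> \<le> \<epsilon>"
proof -
  note fb = continuous_on_bounded_measurable[OF assms(1)]
  have "uniform_limit {0..1} (\<lambda>t. transition X t f) f (at_right 0)"
    using feller assms(1) by (simp add: feller_diffusion_def feller_property_def)
  then have "\<forall>\<^sub>F t in at_right 0. \<forall>x\<in>{0..1}. dist (transition X t f x) (f x) < \<epsilon>"
    using assms(2) by (rule uniform_limitD)
  then obtain \<delta> where \<delta>: "\<delta> > 0"
    "\<And>t x. 0 < t \<Longrightarrow> t < \<delta> \<Longrightarrow> x \<in> {0..1} \<Longrightarrow> \<bar>transition X t f x - f x\<bar> < \<epsilon>"
    by (auto simp: eventually_at_right_field dist_real_def)
  \<comment> \<open>The limit along \<open>at_right 0\<close> says nothing about time 0 itself,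
    where \<open>transition_0\<close> is used instead.\<close>
  have start: "\<bar>transition X t f x - f x\<bar> \<le> \<epsilon>" if "0 \<le> t" "t < \<delta>" "x \<in> {0..1}" for t x
    using \<delta>(2)[of t x] transition_0[OF that(3) fb] that assms(2) by (cases "t = 0") auto
  have le: "\<bar>transition X s f x - transition X t f x\<bar> \<le> \<epsilon>"
    if "0 \<le> s" "s \<le> t" "t - s < \<delta>" "x \<in> {0..1}" for s t x
  proof -
    have "transition X t f x = transition X s (transition X (t - s) f) x"
      using transition_add[of s "t - s" x f] that assms(1) by simp
    moreover have "\<bar>transition X s f x - transition X s (transition X (t - s) f) x\<bar> \<le> \<epsilon>"
      using that start[of "t - s"] assms(1)
      by (intro abs_transition_diff_le fb continuous_on_bounded_measurable continuous_transition)
        (auto simp: abs_minus_commute)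
    ultimately show ?thesis by simp
  qed
  show thesis
  proof (rule that[OF \<delta>(1)])
    fix s t x :: real
    assume "0 \<le> s" "0 \<le> t" "\<bar>s - t\<bar> < \<delta>" "x \<in> {0..1}"
    then show "\<bar>transition X s f x - transition X t f x\<bar> \<le> \<epsilon>"
      using le[of s t x] le[of t s x] by (cases "s \<le> t") (auto simp: abs_minus_commute)
  qed
qed

text \<open>Continuity in time is uniform in the starting point, so it combines with continuity in
  space at one fixed time. The joint version supplies measurability for Fubini's theorem and
  continuity of time integrals.\<close>

lemma continuous_transition_joint:
  assumes "continuous_on {0..1} f"
  shows "continuous_on ({0..1} \<times> {0..}) (\<lambda>(x, t). transition X t f x)"
  unfolding continuous_on_iff
proof (intro ballI allI impI)
  fix p :: "real \<times> real" and \<epsilon> :: real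
  assume "p \<in> {0..1} \<times> {0..}" and \<epsilon>: "0 < \<epsilon>"
  then obtain x t where p: "p = (x, t)" and x: "0 \<le> x" "x \<le> 1" and t: "0 \<le> t" by auto
  obtain \<delta>1 where \<delta>1: "\<delta>1 > 0"
    "\<And>s t x. \<lbrakk>0 \<le> s; 0 \<le> t; \<bar>s - t\<bar> < \<delta>1; x \<in> {0..1}\<rbrakk>
        \<Longrightarrow> \<bar>transition X s f x - transition X t f x\<bar> \<le> \<epsilon> / 3"
    using transition_small_time[OF assms, of "\<epsilon> / 3"] \<epsilon> by auto
  obtain \<delta>2 where \<delta>2: "\<delta>2 > 0"
    "\<And>y. y \<in> {0..1} \<Longrightarrow> dist y x < \<delta>2 \<Longrightarrow> dist (transition X t f y) (transition X t f x) < \<epsilon> / 3"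
    using continuous_transition[OF assms t] \<epsilon> x
    by (metis atLeastAtMost_iff continuous_on_iff zero_less_divide_iff zero_less_numeral)
  have "dist (transition X s f y) (transition X t f x) < \<epsilon>"
    if "0 \<le> y" "y \<le> 1" "0 \<le> s" "dist (y, s) (x, t) < min \<delta>1 \<delta>2" for y s
  proof -
    have "dist y x < \<delta>2" "\<bar>s - t\<bar> < \<delta>1"
      using that(4) dist_fst_le[of "(y, s)" "(x, t)"] dist_snd_le[of "(y, s)" "(x, t)"]
      by (auto simp: dist_real_def)
    then show ?thesis
      using \<delta>1(2)[of s t y] \<delta>2(2)[of y] that(1-3) t \<epsilon> unfolding dist_real_def atLeastAtMost_iff
      by linarith
  qed
  then show "\<exists>\<delta>>0. \<forall>q\<in>{0..1} \<times> {0..}. dist q p < \<delta> \<longrightarrow>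
      dist (case q of (y, s) \<Rightarrow> transition X s f y) (case p of (y, s) \<Rightarrow> transition X s f y) < \<epsilon>"
    using \<delta>1(1) \<delta>2(1) by (intro exI[of _ "min \<delta>1 \<delta>2"]) (auto simp: p)
qed

section \<open>Time averages and density of the domain of the generator\<close>

lemma continuous_transition_time:
  assumes "continuous_on {0..1} f" "x \<in> {0..1}"
  shows "continuous_on {0..} (\<lambda>t. transition X t f x)"
proof -
  have "continuous_on {0..} ((\<lambda>(x, t). transition X t f x) \<circ> (\<lambda>t. (x, t)))"
    using assms(2)
    by (intro continuous_on_compose continuous_intros
        continuous_on_subset[OF continuous_transition_joint[OF assms(1)]]) auto
  then show ?thesis by (simp add: comp_def)
qed

text \<open>The integral of the orbit of \<open>f\<close> under the semigroup. A gauge integral fits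
  the splitting and shifting of time intervals; the Lebesgue form serves Fubini's theorem.\<close>

definition time_integral :: "real \<Rightarrow> (real \<Rightarrow> real) \<Rightarrow> real \<Rightarrow> real" where
  "time_integral t f x = integral {0..t} (\<lambda>s. transition X s f x)"

lemma continuous_time_integral:
  assumes "continuous_on {0..1} f"
  shows "continuous_on {0..1} (time_integral t f)"
proof -
  have "continuous_on ({0..1} \<times> cbox 0 t) (\<lambda>(x, s). transition X s f x)"
    by (rule continuous_on_subset[OF continuous_transition_joint[OF assms]]) auto
  then show ?thesis
    unfolding time_integral_def box_real(2)[symmetric] by (rule integral_continuous_on_param)
qed

lemma time_integral_lebesgue:
  assumes "continuous_on {0..1} f" "x \<in> {0..1}"
  shows "time_integral t f x = (\<integral>s. transition X s f x \<partial>restrict_space lborel {0..t})"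
proof -
  have "set_integrable lborel {0..t} (\<lambda>s. transition X s f x)"
    by (rule borel_integrable_atLeastAtMost', rule continuous_on_subset[OF continuous_transition_time[OF assms]]) auto
  from set_borel_integral_eq_integral(2)[OF this] show ?thesis
    by (simp add: time_integral_def integral_restrict_space set_lebesgue_integral_def)
qed

text \<open>Fubini's theorem moves the expectation at time \<open>r\<close> inside the time
  integral, the semigroup identity merges the two times, and a shift moves the interval.\<close>

lemma transition_time_integral:
  assumes f: "continuous_on {0..1} f" and "t \<ge> 0" "r \<ge> 0" and x: "x \<in> {0..1}"
  shows "transition X r (time_integral t f) x = integral {r..r + t} (\<lambda>s. transition X s f x)"
proof -
  let ?L = "restrict_space lborel {0..t}" and ?J = "\<lambda>(y, s). transition X s f y"
  interpret W: prob_space "law X x" by (rule prob_space_law[OF x])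
  interpret L: finite_measure ?L
    by (rule finite_measureI) (simp add: emeasure_restrict_space space_restrict_space assms(2))
  interpret pair_sigma_finite ?L "law X x" ..
  interpret PL: finite_measure "?L \<Otimes>\<^sub>M law X x"
  proof (rule finite_measureI)
    have "emeasure (?L \<Otimes>\<^sub>M law X x) (space ?L \<times> space (law X x))
        = emeasure ?L (space ?L) * emeasure (law X x) (space (law X x))"
      by (intro W.emeasure_pair_measure_Times sets.top)
    then show "emeasure (?L \<Otimes>\<^sub>M law X x) (space (?L \<Otimes>\<^sub>M law X x)) \<noteq> \<infinity>"
      by (simp add: space_pair_measure W.emeasure_space_1 del: space_restrict_space)
  qed
  obtain K where K: "\<And>y. y \<in> {0..1} \<Longrightarrow> \<bar>f y\<bar> \<le> K"
    using continuous_on_Icc_bound[OF f] by blast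
  have fb: "f \<in> bounded_measurable" by (rule continuous_on_bounded_measurable[OF f])
  have coord: "coord X r \<in> law X x \<rightarrow>\<^sub>M borel"
    using coord_measurable[OF assms(3) x] by (simp add: unit_borel_def measurable_restrict_space2_iff)
  \<comment> \<open>Joint measurability comes from composing this map with a function known to be
    continuous only on \<open>{0..1} \<times> {0..}\<close>, so the map must land there.\<close>
  have 1: "(\<lambda>p. (coord X r (snd p), fst p)) \<in> ?L \<Otimes>\<^sub>M law X x \<rightarrow>\<^sub>M restrict_space borel ({0..1} \<times> {0..})"
  proof (rule measurable_restrict_space2)
    show "(\<lambda>p. (coord X r (snd p), fst p)) \<in> space (?L \<Otimes>\<^sub>M law X x) \<rightarrow> {0..1} \<times> {0..}"
      using coord_in[OF assms(3) x] by (auto simp: space_pair_measure space_restrict_space)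
    have "fst \<in> ?L \<Otimes>\<^sub>M law X x \<rightarrow>\<^sub>M borel"
      by (rule measurable_compose[OF measurable_fst]) (rule measurable_restrict_space1, simp)
    then show "(\<lambda>p. (coord X r (snd p), fst p)) \<in> ?L \<Otimes>\<^sub>M law X x \<rightarrow>\<^sub>M borel"
      using measurable_compose[OF measurable_snd coord]
      unfolding borel_prod[symmetric] by (intro measurable_Pair) auto
  qed
  have "?J \<in> borel_measurable (restrict_space borel ({0..1} \<times> {0..}))"
    by (rule borel_measurable_continuous_on_restrict[OF continuous_transition_joint[OF f]])
  from measurable_compose[OF 1 this]
  have meas: "(\<lambda>(s, \<omega>). transition X s f (coord X r \<omega>)) \<in> borel_measurable (?L \<Otimes>\<^sub>M law X x)"
    by (simp add: case_prod_beta)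
  have "\<bar>transition X s f (coord X r \<omega>)\<bar> \<le> K" if "s \<in> {0..t}" "\<omega> \<in> space (law X x)" for s \<omega>
    using abs_transition_diff_le[OF _ coord_in[OF assms(3) x that(2)] fb, of s "\<lambda>_. 0" K] that(1) K
    by (auto simp: transition_def continuous_on_bounded_measurable)
  then have "integrable (?L \<Otimes>\<^sub>M law X x) (\<lambda>(s, \<omega>). transition X s f (coord X r \<omega>))"
    by (intro PL.integrable_const_bound[OF _ meas, of K] AE_I2)
      (auto simp: space_pair_measure space_restrict_space)
  from Fubini_integral[OF this]
  have "(\<integral>\<omega>. (\<integral>s. transition X s f (coord X r \<omega>) \<partial>?L) \<partial>law X x)
      = (\<integral>s. (\<integral>\<omega>. transition X s f (coord X r \<omega>) \<partial>law X x) \<partial>?L)" .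
  moreover have "(\<integral>\<omega>. (\<integral>s. transition X s f (coord X r \<omega>) \<partial>?L) \<partial>law X x)
      = transition X r (time_integral t f) x"
    unfolding transition_def[of X r]
    by (intro Bochner_Integration.integral_cong refl time_integral_lebesgue[symmetric] f coord_in[OF assms(3) x])
  moreover have "(\<integral>s. (\<integral>\<omega>. transition X s f (coord X r \<omega>) \<partial>law X x) \<partial>?L)
      = (\<integral>s. transition X (r + s) f x \<partial>?L)"
    by (intro Bochner_Integration.integral_cong refl)
      (simp add: space_restrict_space transition_add[OF assms(3) _ x f] transition_def[of X r])
  moreover have "(\<integral>s. transition X (r + s) f x \<partial>?L) = integral {0..t} (\<lambda>s. transition X (r + s) f x)"
  proof -
    have "continuous_on {0..t} ((\<lambda>s. transition X s f x) \<circ> (\<lambda>s. r + s))"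
      using assms(3) by (intro continuous_on_compose continuous_intros
          continuous_on_subset[OF continuous_transition_time[OF f x]]) auto
    then have "set_integrable lborel {0..t} (\<lambda>s. transition X (r + s) f x)"
      by (intro borel_integrable_atLeastAtMost') (simp add: comp_def)
    from set_borel_integral_eq_integral(2)[OF this] show ?thesis
      by (simp add: integral_restrict_space set_lebesgue_integral_def)
  qed
  moreover have "integral {0..t} (\<lambda>s. transition X (r + s) f x) = integral {r..r + t} (\<lambda>s. transition X s f x)"
    using integral_shift[of 0 r t "\<lambda>s. transition X s f x"]
    by (simp add: continuous_on_subset[OF continuous_transition_time[OF f x]] assms add.commute comp_def)
  ultimately show ?thesis by simp
qed

lemma integral_transition_approx:
  assumes f: "continuous_on {0..1} f" and "p \<ge> 0" "r \<ge> 0" and x: "x \<in> {0..1}"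
    and "\<And>s. s \<in> {p..p + r} \<Longrightarrow> \<bar>transition X s f x - transition X p f x\<bar> \<le> \<epsilon>"
  shows "\<bar>integral {p..p + r} (\<lambda>s. transition X s f x) - r * transition X p f x\<bar> \<le> \<epsilon> * r"
proof -
  have cont: "continuous_on {p..p + r} (\<lambda>s. transition X s f x)"
    by (rule continuous_on_subset[OF continuous_transition_time[OF f x]]) (use assms(2) in auto)
  have "\<bar>integral {p..p + r} (\<lambda>s. transition X s f x - transition X p f x)\<bar> \<le> \<epsilon> * (p + r - p)"
    using assms(3,5) unfolding real_norm_def[symmetric]
    by (intro integral_bound continuous_intros cont) auto
  then show ?thesis
    using assms(3) by (simp add: Henstock_Kurzweil_Integration.integral_diff integrable_continuous_real cont)
qed

text \<open>The overlap of \<open>{0..t}\<close> and \<open>{r..r + t}\<close> cancels, so the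
  difference quotient consists of two averages over intervals of length \<open>r\<close>, starting
  at times \<open>t\<close> and 0. They converge uniformly to the values of the orbit there.\<close>

lemma time_average_in_domain:
  assumes f: "continuous_on {0..1} f" and t: "t > 0"
  shows "(\<lambda>x. time_integral t f x / t) \<in> generator_domain X"
proof -
  let ?h = "\<lambda>x. time_integral t f x / t" and ?g = "\<lambda>x. (transition X t f x - f x) / t"
  have "continuous_on {0..1} ?h"
    using t by (intro continuous_intros continuous_time_integral f) simp
  moreover have "continuous_on {0..1} ?g"
    using t by (intro continuous_intros continuous_transition f) auto
  moreover have "uniform_limit {0..1} (\<lambda>r x. (transition X r ?h x - ?h x) / r) ?g (at_right 0)"
  proof (rule uniform_limitI)
    fix \<epsilon> :: real
    assume \<epsilon>: "\<epsilon> > 0"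
    \<comment> \<open>Two errors of at most \<open>\<epsilon> * t * r / 3\<close> each are later
      divided by \<open>t * r\<close>, which leaves less than \<open>\<epsilon>\<close>.\<close>
    obtain \<delta> where \<delta>: "\<delta> > 0"
      "\<And>s u x. \<lbrakk>0 \<le> s; 0 \<le> u; \<bar>s - u\<bar> < \<delta>; x \<in> {0..1}\<rbrakk>
        \<Longrightarrow> \<bar>transition X s f x - transition X u f x\<bar> \<le> \<epsilon> * t / 3"
      using transition_small_time[OF f, of "\<epsilon> * t / 3"] t \<epsilon> by auto
    have "dist ((transition X r ?h x - ?h x) / r) (?g x) < \<epsilon>"
      if r: "0 < r" "r < \<delta>" and x: "x \<in> {0..1}" for r x
    proof -
      let ?\<phi> = "\<lambda>s. transition X s f x"
      define A where "A = integral {t..t + r} ?\<phi> - r * ?\<phi> t"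
      define B where "B = integral {0..0 + r} ?\<phi> - r * ?\<phi> 0"
      have int: "?\<phi> integrable_on {0..r + t}"
        by (intro integrable_continuous_real continuous_on_subset[OF continuous_transition_time[OF f x]]) auto
      have "\<bar>A\<bar> \<le> \<epsilon> * t / 3 * r" "\<bar>B\<bar> \<le> \<epsilon> * t / 3 * r"
        unfolding A_def B_def
        by (intro integral_transition_approx f x; use \<delta>(2)[OF _ _ _ x] r t in auto)+
      then have *: "\<bar>A\<bar> \<le> \<epsilon> * t * r / 3" "\<bar>B\<bar> \<le> \<epsilon> * t * r / 3"
        by simp_all
      have "transition X r ?h x = integral {r..r + t} ?\<phi> / t"
        using transition_time_integral[OF f _ _ x, of t r] r t by (simp add: transition_def)
      \<comment> \<open>Both sums are the integral over \<open>{0..r + t}\<close>, split once at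
        \<open>r\<close> and once at \<open>t\<close>.\<close>
      moreover have "integral {0..r} ?\<phi> + integral {r..r + t} ?\<phi> = integral {0..t} ?\<phi> + integral {t..t + r} ?\<phi>"
        using Henstock_Kurzweil_Integration.integral_combine[OF _ _ int, of r]
          Henstock_Kurzweil_Integration.integral_combine[OF _ _ int, of t] r t
        by (simp add: add.commute)
      ultimately have "transition X r ?h x - ?h x = (integral {t..t + r} ?\<phi> - integral {0..r} ?\<phi>) / t"
        by (simp add: time_integral_def diff_divide_distrib[symmetric])
      then have eq: "(transition X r ?h x - ?h x) / r - ?g x = (A - B) / (t * r)"
        unfolding A_def B_def add_0 transition_0[OF x continuous_on_bounded_measurable[OF f]]
        using r t by (simp add: diff_divide_distrib)
      moreover have "\<bar>A - B\<bar> < \<epsilon> * (t * r)"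
      proof -
        have "\<bar>A - B\<bar> \<le> 2 / 3 * (\<epsilon> * t * r)" using * by linarith
        also have "\<dots> < \<epsilon> * (t * r)" using \<epsilon> t r by simp
        finally show ?thesis .
      qed
      ultimately show ?thesis
        using r t unfolding dist_real_def eq by (simp add: divide_less_eq)
    qed
    then show "\<forall>\<^sub>F r in at_right 0. \<forall>x\<in>{0..1}. dist ((transition X r ?h x - ?h x) / r) (?g x) < \<epsilon>"
      using \<delta>(1) by (auto simp: eventually_at_right_field)
  qed
  ultimately show ?thesis
    unfolding generator_domain_def by blast
qed

text \<open>Averages of the orbit over short times lie in the domain and, by the uniform modulus in
  time, are uniformly close to \<open>f\<close>.\<close>

lemma generator_domain_dense:
  assumes f: "continuous_on {0..1} f" and \<epsilon>: "\<epsilon> > 0"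
  obtains g where "g \<in> generator_domain X" "\<And>x. x \<in> {0..1} \<Longrightarrow> \<bar>g x - f x\<bar> \<le> \<epsilon>"
proof -
  obtain \<delta> where \<delta>: "\<delta> > 0"
    "\<And>s u x. \<lbrakk>0 \<le> s; 0 \<le> u; \<bar>s - u\<bar> < \<delta>; x \<in> {0..1}\<rbrakk>
      \<Longrightarrow> \<bar>transition X s f x - transition X u f x\<bar> \<le> \<epsilon>"
    using transition_small_time[OF f \<epsilon>] by auto
  have "\<bar>time_integral (\<delta> / 2) f x / (\<delta> / 2) - f x\<bar> \<le> \<epsilon>" if x: "x \<in> {0..1}" for x
  proof -
    have "\<bar>integral {0..0 + \<delta> / 2} (\<lambda>s. transition X s f x) - \<delta> / 2 * transition X 0 f x\<bar> \<le> \<epsilon> * (\<delta> / 2)"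
      by (intro integral_transition_approx f x; use \<delta>(2)[OF _ _ _ x] \<delta>(1) in auto)
    then have "\<bar>time_integral (\<delta> / 2) f x - \<delta> / 2 * f x\<bar> \<le> \<epsilon> * (\<delta> / 2)"
      by (simp add: time_integral_def transition_0[OF x continuous_on_bounded_measurable[OF f]])
    moreover have "time_integral (\<delta> / 2) f x / (\<delta> / 2) - f x = (time_integral (\<delta> / 2) f x - \<delta> / 2 * f x) / (\<delta> / 2)"
      using \<delta>(1) by (simp add: field_simps)
    ultimately show ?thesis
      using \<delta>(1) by (simp only: abs_divide) (simp add: field_simps)
  qed
  then show thesis
    using that time_average_in_domain[OF f, of "\<delta> / 2"] \<delta>(1) by simp
qed

section \<open>The generator: linearity and the positive maximum principle\<close>

lemma continuous_domain: "f \<in> generator_domain X \<Longrightarrow> continuous_on {0..1} f"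
  by (simp add: generator_domain_def)

text \<open>\<open>generator\<close> is defined by pointwise limits; on \<open>{0..1}\<close> they
  agree with the uniform limit that membership in the domain provides.\<close>

lemma generator_limit:
  assumes "f \<in> generator_domain X"
  shows continuous_generator: "continuous_on {0..1} (generator X f)"
    and uniform_limit_generator:
      "uniform_limit {0..1} (\<lambda>t x. (transition X t f x - f x) / t) (generator X f) (at_right 0)"
proof -
  obtain g where g: "continuous_on {0..1} g"
      "uniform_limit {0..1} (\<lambda>t x. (transition X t f x - f x) / t) g (at_right 0)"
    using assms by (auto simp: generator_domain_def)
  have eq: "generator X f x = g x" if "x \<in> {0..1}" for x
    unfolding generator_def by (rule tendsto_Lim[OF _ tendsto_uniform_limitI[OF g(2) that]]) simp
  show "continuous_on {0..1} (generator X f)"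
    by (rule continuous_on_eq[OF g(1)]) (simp add: eq)
  show "uniform_limit {0..1} (\<lambda>t x. (transition X t f x - f x) / t) (generator X f) (at_right 0)"
    by (rule uniform_limit_cong'[THEN iffD1, OF _ _ g(2)]) (simp_all add: eq)
qed

lemma generator_linear:
  assumes f: "f \<in> generator_domain X" and g: "g \<in> generator_domain X"
  shows domain_linear: "(\<lambda>y. u * f y + v * g y) \<in> generator_domain X"
    and generator_add_scaled:
      "x \<in> {0..1} \<Longrightarrow> generator X (\<lambda>y. u * f y + v * g y) x = u * generator X f x + v * generator X g x"
proof -
  let ?h = "\<lambda>y. u * f y + v * g y" and ?k = "\<lambda>x. u * generator X f x + v * generator X g x"
  have "uniform_limit {0..1}
      (\<lambda>t x. u * ((transition X t f x - f x) / t) + v * ((transition X t g x - g x) / t)) ?k (at_right 0)"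
    by (intro uniform_limit_add bounded_linear.uniform_limit[OF bounded_linear_mult_right]
        uniform_limit_generator f g)
  moreover have "\<forall>\<^sub>F t in at_right 0. \<forall>x\<in>{0..1}.
      u * ((transition X t f x - f x) / t) + v * ((transition X t g x - g x) / t)
      = (transition X t ?h x - ?h x) / t"
    using eventually_at_right_less[of "0 :: real"]
  proof eventually_elim
    case (elim t)
    then show ?case
      using continuous_on_bounded_measurable[OF continuous_domain] f g
      by (simp add: transition_add_scaled field_simps)
  qed
  ultimately have lim: "uniform_limit {0..1} (\<lambda>t x. (transition X t ?h x - ?h x) / t) ?k (at_right 0)"
    by (rule uniform_limit_cong[THEN iffD1, rotated 2]) auto
  have "continuous_on {0..1} ?h" "continuous_on {0..1} ?k"
    by (intro continuous_intros continuous_domain continuous_generator f g)+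
  with lim show "?h \<in> generator_domain X"
    unfolding generator_domain_def by blast
  show "generator X ?h x = ?k x" if "x \<in> {0..1}"
    unfolding generator_def[of X ?h]
    by (rule tendsto_Lim[OF _ tendsto_uniform_limitI[OF lim that]]) simp
qed

text \<open>At a maximum point the mean of \<open>f\<close> at a later time cannot exceed
  \<open>f x\<close>, so every difference quotient with \<open>t > 0\<close> is nonpositive.\<close>

lemma positive_maximum_principle:
  assumes f: "f \<in> generator_domain X" and x: "x \<in> {0..1}"
    and "\<And>y. y \<in> {0..1} \<Longrightarrow> f y \<le> f x"
  shows "generator X f x \<le> 0"
proof (rule tendsto_upperbound[OF tendsto_uniform_limitI[OF uniform_limit_generator[OF f] x]])
  show "\<forall>\<^sub>F t in at_right 0. (transition X t f x - f x) / t \<le> 0"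
    using eventually_at_right_less[of "0 :: real"]
  proof eventually_elim
    case (elim t)
    then show ?case
      using transition_le[OF _ x continuous_on_bounded_measurable[OF continuous_domain[OF f]], of t "f x"]
        assms(3) by (simp add: divide_le_0_iff)
  qed
qed simp

end

section \<open>Integrals over the open unit interval\<close>

lemma LBINT_has_derivative:
  fixes p :: "real \<Rightarrow> real" and c x :: real
  assumes "continuous_on {0<..<1} p" "c \<in> {0<..<1}" "x \<in> {0<..<1}"
  shows "((\<lambda>u. LBINT y=c..u. p y) has_real_derivative p x) (at x)"
proof -
  \<comment> \<open>A compact subinterval of the open unit interval with \<open>c\<close> and
    \<open>x\<close> in its interior; \<open>p\<close> is continuous on all of it, as the
    fundamental theorem requires.\<close>
  define l where "l = min c x / 2"
  define r where "r = (max c x + 1) / 2"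
  have lr: "0 < l" "l < c" "l < x" "c < r" "x < r" "r < 1"
    using assms by (auto simp: l_def r_def min_def max_def)
  have "((\<lambda>u. LBINT y=c..u. p y) has_vector_derivative p x) (at x within {l..r})"
    by (rule interval_integral_FTC2) (use lr in \<open>auto intro!: continuous_on_subset[OF assms(1)]\<close>)
  then show ?thesis
    using lr by (simp add: at_within_Icc_at has_real_derivative_iff_has_vector_derivative)
qed

lemma continuous_on_indicator_measurable:
  fixes p :: "real \<Rightarrow> real"
  assumes "continuous_on {0<..<1} p" "V \<subseteq> {0<..<1}" "V \<in> sets borel"
  shows "(\<lambda>x. indicator V x * p x) \<in> borel_measurable lborel"
  using borel_measurable_continuous_on_indicator[OF assms(3) continuous_on_subset[OF assms(1,2)]]
  by simp

text \<open>Common shape of \<open>N0\<close>, \<open>Sigma0\<close>, \<open>N1\<close> and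
  \<open>Sigma1\<close>: \<open>p\<close> is the scale or the speed density and \<open>w\<close> an
  increment of the other function.\<close>

lemma nn_integral_weight:
  fixes p w :: "real \<Rightarrow> real"
  assumes p: "continuous_on {0<..<1} p" and w: "continuous_on {0<..<1} w"
    and U: "U \<subseteq> {0<..<1}" "U \<in> sets borel"
  shows "(\<integral>\<^sup>+\<eta>\<in>U. ennreal (w \<eta>) \<partial>density lborel (\<lambda>x. indicator {0<..<1} x * ennreal (p x)))
    = (\<integral>\<^sup>+\<eta>. ennreal (indicator U \<eta> * p \<eta>) * ennreal (w \<eta>) \<partial>lborel)"
proof -
  have 1: "(\<lambda>x. indicator {0<..<1} x * ennreal (p x)) \<in> borel_measurable lborel"
    using measurable_compose[OF continuous_on_indicator_measurable[OF p order.refl] measurable_ennreal]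
    by (simp add: ennreal_mult' ennreal_indicator)
  have "(\<lambda>x. ennreal (w x) * indicator U x) = (\<lambda>x. ennreal (indicator U x * w x))"
    by (auto simp: indicator_def)
  then have 2: "(\<lambda>x. ennreal (w x) * indicator U x) \<in> borel_measurable lborel"
    using measurable_compose[OF continuous_on_indicator_measurable[OF w U] measurable_ennreal] by simp
  show ?thesis
    unfolding nn_integral_density[OF 1 2] using U(1)
    by (intro nn_integral_cong) (auto simp: indicator_def split: if_splits)
qed

lemma weight_finite:
  fixes p w h :: "real \<Rightarrow> real"
  assumes "continuous_on {0<..<1} p" "continuous_on {0<..<1} w" "U \<subseteq> {0<..<1}" "U \<in> sets borel"
    and h: "set_integrable lborel U h"
    and nonneg: "\<And>\<eta>. \<eta> \<in> U \<Longrightarrow> p \<eta> \<ge> 0" and le: "\<And>\<eta>. \<eta> \<in> U \<Longrightarrow> p \<eta> * w \<eta> \<le> h \<eta>"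
  shows "(\<integral>\<^sup>+\<eta>\<in>U. ennreal (w \<eta>) \<partial>density lborel (\<lambda>x. indicator {0<..<1} x * ennreal (p x))) < \<infinity>"
proof -
  have "(\<integral>\<^sup>+\<eta>. ennreal (indicator U \<eta> * p \<eta>) * ennreal (w \<eta>) \<partial>lborel)
      \<le> (\<integral>\<^sup>+\<eta>. ennreal (norm (indicator U \<eta> *\<^sub>R h \<eta>)) \<partial>lborel)"
  proof (rule nn_integral_mono)
    fix \<eta>
    show "ennreal (indicator U \<eta> * p \<eta>) * ennreal (w \<eta>) \<le> ennreal (norm (indicator U \<eta> *\<^sub>R h \<eta>))"
      using nonneg[of \<eta>] le[of \<eta>]
      by (cases "\<eta> \<in> U") (auto simp: ennreal_mult'[symmetric] intro!: ennreal_leI)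
  qed
  also have "\<dots> < \<infinity>"
    using h by (simp add: set_integrable_def integrable_iff_bounded)
  finally show ?thesis
    by (simp add: nn_integral_weight[OF assms(1-4)])
qed

text \<open>Where the weight is at least \<open>\<delta>\<close>, the density is at most
  \<open>1 / \<delta>\<close> times the weighted density. So finiteness of a boundary quantity
  passes to the density near that boundary.\<close>

lemma weight_integrable:
  fixes p w :: "real \<Rightarrow> real"
  assumes p: "continuous_on {0<..<1} p" and "continuous_on {0<..<1} w"
    and U: "U \<subseteq> {0<..<1}" "U \<in> sets borel"
    and fin: "(\<integral>\<^sup>+\<eta>\<in>U. ennreal (w \<eta>) \<partial>density lborel (\<lambda>x. indicator {0<..<1} x * ennreal (p x))) < \<infinity>"
    and V: "V \<subseteq> U" "V \<in> sets borel" and \<delta>: "\<delta> > 0" "\<And>\<eta>. \<eta> \<in> V \<Longrightarrow> \<delta> \<le> w \<eta>"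
    and nonneg: "\<And>\<eta>. \<eta> \<in> V \<Longrightarrow> p \<eta> \<ge> 0"
  shows "set_integrable lborel V p"
  unfolding set_integrable_def
proof (rule integrableI_bounded)
  have meas: "(\<lambda>x. indicator V x * p x) \<in> borel_measurable lborel"
    using V U by (intro continuous_on_indicator_measurable p) auto
  then show "(\<lambda>x. indicator V x *\<^sub>R p x) \<in> borel_measurable lborel"
    by simp
  have "ennreal \<delta> * (\<integral>\<^sup>+\<eta>. ennreal (norm (indicator V \<eta> *\<^sub>R p \<eta>)) \<partial>lborel)
      = (\<integral>\<^sup>+\<eta>. ennreal \<delta> * ennreal (norm (indicator V \<eta> *\<^sub>R p \<eta>)) \<partial>lborel)"
    by (rule nn_integral_cmult[symmetric]) (use meas in simp)
  also have "\<dots> \<le> (\<integral>\<^sup>+\<eta>. ennreal (indicator U \<eta> * p \<eta>) * ennreal (w \<eta>) \<partial>lborel)"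
  proof (rule nn_integral_mono)
    fix \<eta>
    show "ennreal \<delta> * ennreal (norm (indicator V \<eta> *\<^sub>R p \<eta>)) \<le> ennreal (indicator U \<eta> * p \<eta>) * ennreal (w \<eta>)"
      using nonneg[of \<eta>] \<delta>(2)[of \<eta>] \<delta>(1) V(1)
      by (cases "\<eta> \<in> V")
        (auto simp: subset_iff mult.commute[of "ennreal \<delta>"] intro!: mult_left_mono ennreal_leI)
  qed
  also have "\<dots> < \<infinity>"
    using fin by (simp add: nn_integral_weight[OF assms(1-4)])
  finally show "(\<integral>\<^sup>+\<eta>. ennreal (norm (indicator V \<eta> *\<^sub>R p \<eta>)) \<partial>lborel) < \<infinity>"
    using \<delta>(1) by (auto simp: ennreal_mult_less_top)
qed

lemma set_integrable_interior:
  fixes p :: "real \<Rightarrow> real"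
  assumes "continuous_on {0<..<1} p" "d \<in> {0<..<1}" "e \<in> {0<..<1}"
    and "set_integrable lborel {0<..<d} p" "set_integrable lborel {e<..<1} p"
  shows "set_integrable lborel {0<..<1} p"
proof -
  have "set_integrable lborel {d..e} p"
    by (rule borel_integrable_atLeastAtMost', rule continuous_on_subset[OF assms(1)]) (use assms in auto)
  then have "set_integrable lborel ({0<..<d} \<union> {d..e} \<union> {e<..<1}) p"
    using assms by (intro set_integrable_Un) auto
  then show ?thesis
    by (rule set_integrable_subset) auto
qed

lemma set_integrable_bounded_mult:
  fixes p f :: "real \<Rightarrow> real"
  assumes "continuous_on {0<..<1} p" "continuous_on {0<..<1} f" "V \<subseteq> {0<..<1}" "V \<in> sets borel"
    and "set_integrable lborel V p" "\<And>x. x \<in> V \<Longrightarrow> \<bar>f x\<bar> \<le> K"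
  shows "set_integrable lborel V (\<lambda>x. p x * f x)"
proof (rule set_integrable_bound)
  show "set_integrable lborel V (\<lambda>x. K * p x)"
    using assms(5) by simp
  show "set_borel_measurable lborel V (\<lambda>x. p x * f x)"
    using continuous_on_indicator_measurable[OF continuous_on_mult[OF assms(1,2)] assms(3,4)]
    by (simp add: set_borel_measurable_def)
  have "\<bar>p x * f x\<bar> \<le> \<bar>K * p x\<bar>" if "x \<in> V" for x
    using mult_right_mono[OF order_trans[OF assms(6)[OF that] abs_ge_self] abs_ge_zero[of "p x"]]
    by (simp add: abs_mult mult.commute)
  then show "AE x in lborel. x \<in> V \<longrightarrow> norm (p x * f x) \<le> norm (K * p x)"
    by simp
qed

text \<open>The base point is the boundary 0, where \<open>p\<close> may blow up; integrability
  takes the place of continuity there, and adding the end points changes no integral.\<close>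

lemma LBINT_from_0:
  fixes p :: "real \<Rightarrow> real"
  assumes p: "continuous_on {0<..<1} p" and int: "set_integrable lborel {0<..<1} p"
  shows continuous_LBINT_from_0: "continuous_on {0..1} (\<lambda>x::real. LBINT y=0..x. p y)"
    and LBINT_from_0_has_derivative:
      "x \<in> {0<..<1} \<Longrightarrow> ((\<lambda>x::real. LBINT y=0..x. p y) has_real_derivative p x) (at x)"
    and LBINT_0_1: "(LBINT y=0..1. p y) = (LINT x:{0<..<1}|lborel. p x)"
proof -
  have int': "set_integrable lborel {0..1} p"
    by (rule set_integrable_discrete_difference[THEN iffD1, OF _ _ _ _ int, of "{0, 1}"]) auto
  have eq: "(LBINT y=0..x. p y) = integral {0..x} p" if "x \<in> {0..1}" for x :: real
  proof -
    have "set_integrable lborel {0..x} p"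
      by (rule set_integrable_subset[OF int']) (use that in auto)
    from interval_integral_eq_integral[OF _ this] show ?thesis
      using that by (simp add: zero_ereal_def)
  qed
  note HK = set_borel_integral_eq_integral(1)[OF int']
  show "continuous_on {0..1} (\<lambda>x::real. LBINT y=0..x. p y)"
    by (rule continuous_on_eq[OF indefinite_integral_continuous_1[OF HK]]) (simp add: eq)
  show "((\<lambda>x::real. LBINT y=0..x. p y) has_real_derivative p x) (at x)" if x: "x \<in> {0<..<1}"
  proof -
    have "isCont p x"
      using p x by (simp add: continuous_on_eq_continuous_at)
    then have "((\<lambda>u. integral {0..u} p) has_vector_derivative p x) (at x within {0..1} - {})"
      using x by (intro integral_has_vector_derivative_continuous_at HK) (auto intro: continuous_at_imp_continuous_within)
    then have "((\<lambda>u. integral {0..u} p) has_real_derivative p x) (at x)"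
      using x by (simp add: at_within_Icc_at has_real_derivative_iff_has_vector_derivative)
    then show ?thesis
      by (rule has_field_derivative_transform_within_open[where S = "{0<..<1}"]) (use x eq in auto)
  qed
  show "(LBINT y=0..1. p y) = (LINT x:{0<..<1}|lborel. p x)"
    using interval_lebesgue_integral_le_eq[of 0 1 lborel p]
    by (simp add: zero_ereal_def one_ereal_def)
qed

text \<open>\<open>F\<close> differs by a constant from the primitive based at 0, which is
  continuous on the compact interval.\<close>

lemma antiderivative_bounded:
  fixes p F :: "real \<Rightarrow> real"
  assumes p: "continuous_on {0<..<1} p" and int: "set_integrable lborel {0<..<1} p"
    and F: "\<And>x. x \<in> {0<..<1} \<Longrightarrow> (F has_real_derivative p x) (at x)"
  obtains K where "\<And>x. x \<in> {0<..<1} \<Longrightarrow> \<bar>F x\<bar> \<le> K"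
proof -
  let ?H = "\<lambda>x::real. LBINT y=0..x. p y"
  have "\<exists>k. \<forall>x\<in>{0<..<1}. F x - ?H x = k"
  proof (rule has_field_derivative_zero_constant)
    fix x :: real
    assume x: "x \<in> {0<..<1}"
    show "((\<lambda>x. F x - ?H x) has_real_derivative 0) (at x within {0<..<1})"
      using DERIV_diff[OF F[OF x] LBINT_from_0_has_derivative[OF p int x]]
      by (simp add: has_field_derivative_at_within)
  qed simp
  then obtain k where k: "\<And>x. x \<in> {0<..<1} \<Longrightarrow> F x - ?H x = k" by blast
  obtain B where B: "\<And>x. x \<in> {0..1} \<Longrightarrow> \<bar>?H x\<bar> \<le> B"
    using continuous_on_Icc_bound[OF continuous_LBINT_from_0[OF p int]] by blast
  have "\<bar>F x\<bar> \<le> \<bar>k\<bar> + B" if "x \<in> {0<..<1}" for x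
    using k[OF that] B[of x] that by auto
  then show thesis by (rule that)
qed

section \<open>Scale and speed\<close>

text \<open>No process occurs, so that the same facts serve the coefficients of \<open>X\<close> and
  those of its dual, with one base point \<open>c\<close>.\<close>

locale interior_coefficients =
  fixes c :: real and a b :: "real \<Rightarrow> real"
  assumes c: "c \<in> {0<..<1}"
    and a: "continuous_on {0<..<1} a" and b: "continuous_on {0<..<1} b"
    and b_pos: "x \<in> {0<..<1} \<Longrightarrow> b x > 0"
begin

abbreviation "s \<equiv> scale_density c a b"
abbreviation "m \<equiv> speed_density c a b"
abbreviation "S \<equiv> scale_fun c a b"
abbreviation "M \<equiv> speed_fun c a b"

lemma s_pos: "s x > 0"
  by (simp add: scale_density_def)

lemma m_pos: "x \<in> {0<..<1} \<Longrightarrow> m x > 0"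
  by (simp add: speed_density_def s_pos b_pos)

lemma s_deriv:
  assumes "x \<in> {0<..<1}"
  shows "(s has_real_derivative - (2 * a x / b x) * s x) (at x)"
proof -
  have "continuous_on {0<..<1} (\<lambda>x. 2 * a x / b x)"
    using b_pos by (intro continuous_intros a b) force
  from LBINT_has_derivative[OF this c assms] show ?thesis
    unfolding scale_density_def by (auto intro!: derivative_eq_intros)
qed

lemma continuous_s: "continuous_on {0<..<1} s"
  using s_deriv by (intro DERIV_continuous_on) (blast intro: has_field_derivative_at_within)

lemma continuous_m: "continuous_on {0<..<1} m"
  unfolding speed_density_def using b_pos s_pos
  by (intro continuous_intros continuous_s b) (metis less_irrefl mult_pos_pos)

lemma S_deriv: "x \<in> {0<..<1} \<Longrightarrow> (S has_real_derivative s x) (at x)"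
  unfolding scale_fun_def by (rule LBINT_has_derivative[OF continuous_s c])

lemma M_deriv: "x \<in> {0<..<1} \<Longrightarrow> (M has_real_derivative m x) (at x)"
  unfolding speed_fun_def by (rule LBINT_has_derivative[OF continuous_m c])

lemma continuous_S: "continuous_on {0<..<1} S"
  using S_deriv by (intro DERIV_continuous_on) (blast intro: has_field_derivative_at_within)

lemma continuous_M: "continuous_on {0<..<1} M"
  using M_deriv by (intro DERIV_continuous_on) (blast intro: has_field_derivative_at_within)

lemma S_less: "\<lbrakk>0 < x; x < y; y < 1\<rbrakk> \<Longrightarrow> S x < S y"
  by (rule DERIV_pos_imp_increasing[of x y S]) (auto intro!: exI conjI S_deriv s_pos)

lemma M_less: "\<lbrakk>0 < x; x < y; y < 1\<rbrakk> \<Longrightarrow> M x < M y"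
  by (rule DERIV_pos_imp_increasing[of x y M]) (auto intro!: exI conjI M_deriv m_pos)

lemma mono_S: "\<lbrakk>0 < x; x \<le> y; y < 1\<rbrakk> \<Longrightarrow> S x \<le> S y"
  using S_less[of x y] by (cases "x = y") auto

lemma mono_M: "\<lbrakk>0 < x; x \<le> y; y < 1\<rbrakk> \<Longrightarrow> M x \<le> M y"
  using M_less[of x y] by (cases "x = y") auto

text \<open>On \<open>{0<..<c/2}\<close> the weight \<open>S c - S \<eta>\<close> is at least
  \<open>S c - S (c/2) > 0\<close>; stopping at \<open>c/2\<close> avoids its zero at
  \<open>c\<close>. The three companions below follow the same pattern, with
  \<open>(1 + c)/2\<close> near 1.\<close>

lemma m_integrable_0:
  assumes "N0 c a b < \<infinity>"
  shows "set_integrable lborel {0<..<c/2} m"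
proof (rule weight_integrable[where U = "{0<..c}" and w = "\<lambda>\<eta>. S c - S \<eta>" and \<delta> = "S c - S (c/2)"])
  show "(\<integral>\<^sup>+\<eta>\<in>{0<..c}. ennreal (S c - S \<eta>) \<partial>density lborel (\<lambda>x. indicator {0<..<1} x * ennreal (m x))) < \<infinity>"
    using assms by (simp add: N0_def speed_measure_def)
qed (use c in \<open>auto intro!: continuous_intros continuous_m continuous_S S_less mono_S less_imp_le[OF m_pos]\<close>)

lemma s_integrable_0:
  assumes "Sigma0 c a b < \<infinity>"
  shows "set_integrable lborel {0<..<c/2} s"
proof (rule weight_integrable[where U = "{0<..c}" and w = "\<lambda>\<eta>. M c - M \<eta>" and \<delta> = "M c - M (c/2)"])
  show "(\<integral>\<^sup>+\<eta>\<in>{0<..c}. ennreal (M c - M \<eta>) \<partial>density lborel (\<lambda>x. indicator {0<..<1} x * ennreal (s x))) < \<infinity>"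
    using assms by (simp add: Sigma0_def scale_measure_def)
qed (use c in \<open>auto intro!: continuous_intros continuous_s continuous_M M_less mono_M less_imp_le[OF s_pos]\<close>)

lemma m_integrable_1:
  assumes "N1 c a b < \<infinity>"
  shows "set_integrable lborel {(1 + c)/2<..<1} m"
proof (rule weight_integrable[where U = "{c..<1}" and w = "\<lambda>\<eta>. S \<eta> - S c" and \<delta> = "S ((1 + c)/2) - S c"])
  show "(\<integral>\<^sup>+\<eta>\<in>{c..<1}. ennreal (S \<eta> - S c) \<partial>density lborel (\<lambda>x. indicator {0<..<1} x * ennreal (m x))) < \<infinity>"
    using assms by (simp add: N1_def speed_measure_def)
qed (use c in \<open>auto intro!: continuous_intros continuous_m continuous_S S_less mono_S less_imp_le[OF m_pos]\<close>)

lemma s_integrable_1: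
  assumes "Sigma1 c a b < \<infinity>"
  shows "set_integrable lborel {(1 + c)/2<..<1} s"
proof (rule weight_integrable[where U = "{c..<1}" and w = "\<lambda>\<eta>. M \<eta> - M c" and \<delta> = "M ((1 + c)/2) - M c"])
  show "(\<integral>\<^sup>+\<eta>\<in>{c..<1}. ennreal (M \<eta> - M c) \<partial>density lborel (\<lambda>x. indicator {0<..<1} x * ennreal (s x))) < \<infinity>"
    using assms by (simp add: Sigma1_def scale_measure_def)
qed (use c in \<open>auto intro!: continuous_intros continuous_s continuous_M M_less mono_M less_imp_le[OF s_pos]\<close>)

lemma integrable_if_regular:
  assumes "regular_at_0 c a b" "regular_at_1 c a b"
  shows "set_integrable lborel {0<..<1} s" "set_integrable lborel {0<..<1} m"
proof -
  have "c / 2 \<in> {0<..<1}" "(1 + c) / 2 \<in> {0<..<1}"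
    using c by auto
  then show "set_integrable lborel {0<..<1} s" "set_integrable lborel {0<..<1} m"
    using assms set_integrable_interior[OF continuous_s _ _ s_integrable_0 s_integrable_1]
      set_integrable_interior[OF continuous_m _ _ m_integrable_0 m_integrable_1]
    by (auto simp: regular_at_0_def regular_at_1_def)
qed

end

section \<open>The stationary distribution and the link\<close>

locale finite_coefficients = interior_coefficients +
  assumes s_int: "set_integrable lborel {0<..<1} s" and m_int: "set_integrable lborel {0<..<1} m"
begin

abbreviation "Z \<equiv> measure (speed_measure c a b) {0<..<1}"
abbreviation "\<pi> \<equiv> stat_density c a b"
abbreviation "P \<equiv> stat_cdf c a b"
abbreviation "\<Lambda> \<equiv> link c a b"

lemma Z_eq: "Z = (LBINT y=0..1. m y)"
proof -
  have "emeasure (speed_measure c a b) {0<..<1} = (\<integral>\<^sup>+x. ennreal (indicator {0<..<1} x *\<^sub>R m x) \<partial>lborel)"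
  proof -
    have "(\<lambda>x. indicator {0<..<1} x * ennreal (m x)) \<in> borel_measurable lborel"
      using measurable_compose[OF continuous_on_indicator_measurable[OF continuous_m order.refl] measurable_ennreal]
      by (simp add: ennreal_mult' ennreal_indicator)
    then show ?thesis
      unfolding speed_measure_def
      by (subst emeasure_density) (auto intro!: nn_integral_cong simp: indicator_def)
  qed
  also have "\<dots> = ennreal (LINT x:{0<..<1}|lborel. m x)"
    unfolding set_lebesgue_integral_def
    using m_int m_pos
    by (intro nn_integral_eq_integral) (auto simp: set_integrable_def indicator_def less_imp_le)
  finally show ?thesis
    unfolding LBINT_0_1[OF continuous_m m_int] measure_def set_lebesgue_integral_def
    using m_pos by (simp add: integral_nonneg_AE indicator_def less_imp_le)
qed

lemma Z_pos: "Z > 0"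
proof -
  have "(LBINT y=0..(0::real). m y) < (LBINT y=0..(1::real). m y)"
    by (rule DERIV_pos_imp_increasing_open[of 0 1 "\<lambda>x::real. LBINT y=0..x. m y"])
      (auto intro!: exI conjI LBINT_from_0_has_derivative m_pos continuous_LBINT_from_0 continuous_m m_int)
  then show ?thesis
    by (simp add: Z_eq zero_ereal_def one_ereal_def)
qed

lemma \<pi>_eq: "\<pi> x = m x / Z"
  by (simp add: stat_density_def)

lemma \<pi>_pos: "x \<in> {0<..<1} \<Longrightarrow> \<pi> x > 0"
  using m_pos Z_pos by (simp add: \<pi>_eq)

lemma continuous_\<pi>: "continuous_on {0<..<1} \<pi>"
  unfolding \<pi>_eq using Z_pos by (intro continuous_intros continuous_m) simp

lemma \<pi>_int: "set_integrable lborel {0<..<1} \<pi>"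
  unfolding \<pi>_eq using m_int by simp

lemma P_0: "P 0 = 0"
  by (simp add: stat_cdf_def zero_ereal_def)

lemma P_1: "P 1 = 1"
  using Z_pos unfolding stat_cdf_def stat_density_def
  by (simp add: one_ereal_def[symmetric] Z_eq)

lemma continuous_P: "continuous_on {0..1} P"
  unfolding stat_cdf_def by (rule continuous_LBINT_from_0[OF continuous_\<pi> \<pi>_int])

lemma P_deriv: "x \<in> {0<..<1} \<Longrightarrow> (P has_real_derivative \<pi> x) (at x)"
  unfolding stat_cdf_def by (rule LBINT_from_0_has_derivative[OF continuous_\<pi> \<pi>_int])

lemma P_less: "\<lbrakk>0 \<le> x; x < y; y \<le> 1\<rbrakk> \<Longrightarrow> P x < P y"
  by (rule DERIV_pos_imp_increasing_open[of x y P])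
    (auto intro!: exI conjI P_deriv \<pi>_pos intro: continuous_on_subset[OF continuous_P])

lemma P_mono: "\<lbrakk>0 \<le> x; x \<le> y; y \<le> 1\<rbrakk> \<Longrightarrow> P x \<le> P y"
  using P_less[of x y] by (cases "x = y") auto

lemma P_pos: "x \<in> {0<..1} \<Longrightarrow> P x > 0"
  using P_less[of 0 x] P_0 by auto

lemma P_bounds: "x \<in> {0..1} \<Longrightarrow> 0 \<le> P x \<and> P x \<le> 1"
  using P_mono[of 0 x] P_mono[of x 1] P_0 P_1 by auto

section \<open>The link as a quotient of primitives\<close>

definition Q :: "(real \<Rightarrow> real) \<Rightarrow> real \<Rightarrow> real" where
  "Q f x = (LBINT y=0..x. \<pi> y * f y)"

lemma \<pi>_mult:
  assumes f: "continuous_on {0..1} f"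
  shows continuous_\<pi>_mult: "continuous_on {0<..<1} (\<lambda>x. \<pi> x * f x)"
    and \<pi>_mult_int: "set_integrable lborel {0<..<1} (\<lambda>x. \<pi> x * f x)"
proof -
  have f': "continuous_on {0<..<1} f"
    by (rule continuous_on_subset[OF f]) auto
  then show "continuous_on {0<..<1} (\<lambda>x. \<pi> x * f x)"
    by (intro continuous_intros continuous_\<pi>)
  obtain K where "\<And>x. x \<in> {0..1} \<Longrightarrow> \<bar>f x\<bar> \<le> K"
    using continuous_on_Icc_bound[OF f] by blast
  then show "set_integrable lborel {0<..<1} (\<lambda>x. \<pi> x * f x)"
    by (intro set_integrable_bounded_mult[OF continuous_\<pi> f' _ _ \<pi>_int, of K]) auto
qed

lemma Q_0: "Q f 0 = 0"
  by (simp add: Q_def zero_ereal_def)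

lemma continuous_Q: "continuous_on {0..1} f \<Longrightarrow> continuous_on {0..1} (Q f)"
  unfolding Q_def by (intro continuous_LBINT_from_0 continuous_\<pi>_mult \<pi>_mult_int)

lemma Q_deriv:
  "continuous_on {0..1} f \<Longrightarrow> x \<in> {0<..<1} \<Longrightarrow> (Q f has_real_derivative \<pi> x * f x) (at x)"
  unfolding Q_def by (intro LBINT_from_0_has_derivative continuous_\<pi>_mult \<pi>_mult_int)

lemma link_eq: "x \<noteq> 0 \<Longrightarrow> \<Lambda> f x = Q f x / P x"
  by (simp add: link_def Q_def)

lemma link_0: "\<Lambda> f 0 = f 0"
  by (simp add: link_def)

lemma link_deriv:
  assumes "continuous_on {0..1} f" "x \<in> {0<..<1}"
  shows "(\<Lambda> f has_real_derivative \<pi> x / P x * (f x - \<Lambda> f x)) (at x)"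
proof -
  have "P x \<noteq> 0" "x \<noteq> 0"
    using P_pos[of x] assms(2) by auto
  then have "((\<lambda>x. Q f x / P x) has_real_derivative \<pi> x / P x * (f x - \<Lambda> f x)) (at x)"
    using assms by (auto intro!: derivative_eq_intros Q_deriv P_deriv simp: link_eq field_simps)
  then show ?thesis
    by (rule has_field_derivative_transform_within_open[where S = "{0<..<1}"])
      (use assms(2) link_eq in auto)
qed

text \<open>Positivity of the averaging, read off from a derivative:
  \<open>\<epsilon> * P - (Q f - Q g)\<close> vanishes at 0 and has derivative
  \<open>\<pi> * (\<epsilon> - (f - g)) \<ge> 0\<close>.\<close>

lemma link_diff_le:
  assumes f: "continuous_on {0..1} f" and g: "continuous_on {0..1} g" and x: "x \<in> {0..1}"
    and le: "\<And>y. y \<in> {0..1} \<Longrightarrow> f y - g y \<le> \<epsilon>"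
  shows "\<Lambda> f x - \<Lambda> g x \<le> \<epsilon>"
proof (cases "x = 0")
  case True
  then show ?thesis using le[of 0] by (simp add: link_0)
next
  case False
  have "\<epsilon> * P 0 - (Q f 0 - Q g 0) \<le> \<epsilon> * P x - (Q f x - Q g x)"
  proof (rule DERIV_nonneg_imp_increasing_open[where f = "\<lambda>y. \<epsilon> * P y - (Q f y - Q g y)"])
    fix y :: real
    assume y: "0 < y" "y < x"
    then have "((\<lambda>y. \<epsilon> * P y - (Q f y - Q g y)) has_real_derivative \<pi> y * (\<epsilon> - (f y - g y))) (at y)"
      using x by (auto intro!: derivative_eq_intros Q_deriv f g P_deriv simp: algebra_simps)
    moreover have "0 \<le> \<pi> y * (\<epsilon> - (f y - g y))"
      using le[of y] \<pi>_pos[of y] x y by simp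
    ultimately show "\<exists>d. ((\<lambda>y. \<epsilon> * P y - (Q f y - Q g y)) has_real_derivative d) (at y) \<and> 0 \<le> d"
      by blast
  next
    have "continuous_on {0..1} (\<lambda>y. \<epsilon> * P y - (Q f y - Q g y))"
      by (intro continuous_intros continuous_P continuous_Q f g)
    then show "continuous_on {0..x} (\<lambda>y. \<epsilon> * P y - (Q f y - Q g y))"
      by (rule continuous_on_subset) (use x in auto)
  qed (use x in auto)
  then show ?thesis
    using False x P_pos[of x] by (simp add: link_eq P_0 Q_0 field_simps)
qed

text \<open>\<open>P^2 / 2\<close> is a primitive of \<open>\<pi> * P\<close>. This makes
  \<open>P\<close> the test function of choice below: \<open>P - \<Lambda> P = P / 2\<close> is
  positive off 0.\<close>

lemma link_P:
  assumes "x \<in> {0..1}"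
  shows "\<Lambda> P x = P x / 2"
proof (cases "x = 0")
  case True
  then show ?thesis by (simp add: link_0 P_0)
next
  case False
  have "Q P x - P x ^ 2 / 2 = Q P 0 - P 0 ^ 2 / 2"
  proof (rule DERIV_isconst_end[where f = "\<lambda>x. Q P x - P x ^ 2 / 2"])
    have "continuous_on {0..1} (\<lambda>x. Q P x - P x ^ 2 / 2)"
      by (intro continuous_intros continuous_Q continuous_P) simp
    then show "continuous_on {0..x} (\<lambda>x. Q P x - P x ^ 2 / 2)"
      by (rule continuous_on_subset) (use assms in auto)
    show "((\<lambda>x. Q P x - P x ^ 2 / 2) has_real_derivative 0) (at y)" if "0 < y" "y < x" for y
      using that assms by (auto intro!: derivative_eq_intros Q_deriv P_deriv continuous_P)
  qed (use False assms in auto)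
  then show ?thesis
    using False assms P_pos[of x] by (simp add: link_eq P_0 Q_0 power2_eq_square field_simps)
qed

lemma link_const: "x \<in> {0..1} \<Longrightarrow> \<Lambda> (\<lambda>_. k) x = k"
  using P_pos[of x]
  by (cases "x = 0") (simp_all add: link_0 link_eq Q_def stat_cdf_def)

lemma link_abs_le:
  assumes "continuous_on {0..1} f" "x \<in> {0..1}" "\<And>y. y \<in> {0..1} \<Longrightarrow> \<bar>f y\<bar> \<le> K"
  shows "\<bar>\<Lambda> f x\<bar> \<le> K"
proof -
  have "\<Lambda> f x - \<Lambda> (\<lambda>_. 0) x \<le> K"
    by (rule link_diff_le) (use assms in \<open>auto simp: abs_le_iff\<close>)
  moreover have "\<Lambda> (\<lambda>_. 0) x - \<Lambda> f x \<le> K"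
    by (rule link_diff_le) (use assms in \<open>auto simp: abs_le_iff\<close>)
  ultimately show ?thesis
    using link_const[OF assms(2), of 0] by (simp add: abs_le_iff)
qed

text \<open>Applied to \<open>F = f' / s\<close> and \<open>g = A f\<close>, since \<open>(f' / s)' = 2 m A f\<close>.\<close>

lemma Q_flux:
  assumes g: "continuous_on {0..1} g"
    and deriv: "\<And>x. x \<in> {0<..<1} \<Longrightarrow> (F has_real_derivative 2 * m x * g x) (at x)"
    and lim0: "(F \<longlongrightarrow> 0) (at_right 0)"
  shows "x \<in> {0<..<1} \<Longrightarrow> Q g x = F x / (2 * Z)"
    and "(F \<longlongrightarrow> 0) (at_left 1) \<Longrightarrow> Q g 1 = 0"
proof -
  have "\<exists>k. \<forall>x\<in>{0<..<1}. Q g x - F x / (2 * Z) = k"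
  proof (rule has_field_derivative_zero_constant)
    fix x :: real
    assume x: "x \<in> {0<..<1}"
    show "((\<lambda>x. Q g x - F x / (2 * Z)) has_real_derivative 0) (at x within {0<..<1})"
      using x Z_pos by (auto intro!: derivative_eq_intros has_field_derivative_at_within[OF Q_deriv[OF g]]
        has_field_derivative_at_within[OF deriv] simp: \<pi>_eq)
  qed simp
  then obtain k where k: "\<And>x. x \<in> {0<..<1} \<Longrightarrow> Q g x - F x / (2 * Z) = k" by blast
  have lims: "(Q g \<longlongrightarrow> 0) (at_right 0)" "(Q g \<longlongrightarrow> Q g 1) (at_left 1)"
    using continuous_on_Icc_at_rightD[OF continuous_Q[OF g]] continuous_on_Icc_at_leftD[OF continuous_Q[OF g]] Q_0
    by simp_all
  \<comment> \<open>The constant \<open>k\<close> is found by letting \<open>x\<close> tend to 0,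
    where both the primitive \<open>Q g\<close> and the flux \<open>F\<close> vanish.\<close>
  have "((\<lambda>x. Q g x - F x / (2 * Z)) \<longlongrightarrow> 0 - 0 / (2 * Z)) (at_right 0)"
    using Z_pos by (intro tendsto_intros lims lim0) simp
  moreover have "\<forall>\<^sub>F x in at_right 0. Q g x - F x / (2 * Z) = k"
    using eventually_at_right_real[of 0 1] k by (auto elim!: eventually_mono)
  ultimately have "((\<lambda>x. k) \<longlongrightarrow> 0) (at_right (0::real))"
    by (auto simp: tendsto_cong)
  then have k0: "k = 0"
    by (simp add: tendsto_const_iff)
  show "x \<in> {0<..<1} \<Longrightarrow> Q g x = F x / (2 * Z)"
    using k k0 by fastforce
  assume "(F \<longlongrightarrow> 0) (at_left 1)"
  then have "((\<lambda>x. F x / (2 * Z)) \<longlongrightarrow> 0 / (2 * Z)) (at_left 1)"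
    using Z_pos by (intro tendsto_intros) auto
  moreover have "\<forall>\<^sub>F x in at_left 1. F x / (2 * Z) = Q g x"
    using eventually_at_left_real[of 0 1] k k0 by (auto elim!: eventually_mono)
  ultimately have "(Q g \<longlongrightarrow> 0) (at_left 1)"
    by (auto simp: tendsto_cong)
  then show "Q g 1 = 0"
    using lims(2) tendsto_unique trivial_limit_at_left_real by blast
qed

end

section \<open>Identification of the dual generator\<close>

lemma C1_differentiable_on_deriv:
  fixes f :: "real \<Rightarrow> real"
  assumes "f C1_differentiable_on U" "x \<in> U"
  shows "(f has_real_derivative deriv f x) (at x)"
  using assms by (metis C1_differentiable_on_def DERIV_imp_deriv has_real_derivative_iff_has_vector_derivative)

lemma C1_differentiable_on_continuous_deriv:
  fixes f :: "real \<Rightarrow> real"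
  assumes "f C1_differentiable_on U"
  shows "continuous_on U (deriv f)"
proof -
  obtain D where D: "\<And>x. x \<in> U \<Longrightarrow> (f has_vector_derivative D x) (at x)" "continuous_on U D"
    using assms by (auto simp: C1_differentiable_on_def)
  have "D x = deriv f x" if "x \<in> U" for x
    using D(1)[OF that] by (metis DERIV_imp_deriv has_real_derivative_iff_has_vector_derivative)
  then show ?thesis
    by (rule continuous_on_eq[OF D(2)])
qed

locale generated_diffusion = interior_coefficients c a b + feller X
  for c a b and X :: "'w diffusion" +
  assumes domain_C1: "f \<in> generator_domain X \<Longrightarrow> f C1_differentiable_on {0<..<1}"
    and domain_C2: "f \<in> generator_domain X \<Longrightarrow> deriv f C1_differentiable_on {0<..<1}"
    and generator_eq: "\<lbrakk>f \<in> generator_domain X; x \<in> {0<..<1}\<rbrakk>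
      \<Longrightarrow> generator X f x = 1/2 * b x * deriv (deriv f) x + a x * deriv f x"
begin

lemmas domain_deriv = C1_differentiable_on_deriv[OF domain_C1]
lemmas domain_deriv2 = C1_differentiable_on_deriv[OF domain_C2]

text \<open>\<open>1 / s\<close> is the integrating factor of the generator: since
  \<open>s' = - (2 * a / b) * s\<close>, the derivative is
  \<open>(f'' + 2 * a / b * f') / s\<close>, and \<open>m = 1 / (s * b)\<close>.\<close>

lemma flux_deriv:
  assumes f: "f \<in> generator_domain X" and x: "x \<in> {0<..<1}"
  shows "((\<lambda>x. deriv f x / s x) has_real_derivative 2 * m x * generator X f x) (at x)"
proof -
  have "s x \<noteq> 0" "b x \<noteq> 0"
    using s_pos[of x] b_pos[OF x] by auto
  then show ?thesis
    by (auto intro!: derivative_eq_intros domain_deriv2[OF f x] s_deriv[OF x]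
        simp: generator_eq[OF f x] speed_density_def field_simps power2_eq_square)
qed

end

locale dual_pair = finite_coefficients c a b + generated_diffusion c a b X
    + D: generated_diffusion c a' b' X'
  for c a b and X :: "'w diffusion" and a' b' and X' :: "'v diffusion" +
  assumes flux_0: "f \<in> generator_domain X \<Longrightarrow> ((\<lambda>x. deriv f x / s x) \<longlongrightarrow> 0) (at_right 0)"
    and flux_1: "f \<in> generator_domain X \<Longrightarrow> ((\<lambda>x. deriv f x / s x) \<longlongrightarrow> 0) (at_left 1)"
    and b_C1: "b C1_differentiable_on {0<..<1}"
    and link_domain: "f \<in> generator_domain X \<Longrightarrow> \<Lambda> f \<in> generator_domain X'"
    and intertwining: "\<lbrakk>f \<in> generator_domain X; x \<in> {0..1}\<rbrakk>
      \<Longrightarrow> \<Lambda> (generator X f) x = generator X' (\<Lambda> f) x"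
begin

section \<open>The intertwining as a relation between coefficients\<close>

definition r :: "real \<Rightarrow> real" where "r x = \<pi> x / P x"

text \<open>Logarithmic derivative of \<open>m\<close>, hence also of \<open>\<pi>\<close>; through
  it the derivative of \<open>b\<close> enters the dual drift.\<close>

definition \<rho> :: "real \<Rightarrow> real" where "\<rho> x = 2 * a x / b x - deriv b x / b x"

text \<open>What multiplies \<open>f - \<Lambda> f\<close> in the intertwining relation once the
  common factor \<open>r\<close> is removed.\<close>

definition \<beta> :: "real \<Rightarrow> real" where "\<beta> x = 1/2 * b' x * (\<rho> x - 2 * r x) + a' x"

lemmas b_deriv = C1_differentiable_on_deriv[OF b_C1]

lemma P_pos': "x \<in> {0<..<1} \<Longrightarrow> P x > 0"
  using P_pos[of x] by simp

lemma r_pos: "x \<in> {0<..<1} \<Longrightarrow> r x > 0"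
  unfolding r_def using \<pi>_pos P_pos' by simp

lemma m_deriv:
  assumes "x \<in> {0<..<1}"
  shows "(m has_real_derivative \<rho> x * m x) (at x)"
proof -
  have "s x \<noteq> 0" "b x \<noteq> 0"
    using s_pos[of x] b_pos[OF assms] by auto
  then show ?thesis
    unfolding speed_density_def \<rho>_def
    by (auto intro!: derivative_eq_intros s_deriv[OF assms] b_deriv[OF assms]
        simp: field_simps power2_eq_square)
qed

text \<open>Logarithmic derivative of a quotient: \<open>\<rho>\<close> from the numerator
  \<open>\<pi>\<close>, minus \<open>r\<close> from the denominator \<open>P\<close>.\<close>

lemma r_deriv:
  assumes "x \<in> {0<..<1}"
  shows "(r has_real_derivative r x * (\<rho> x - r x)) (at x)"
proof -
  have "P x \<noteq> 0"
    using P_pos'[OF assms] by simp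
  moreover have "(\<pi> has_real_derivative \<rho> x * \<pi> x) (at x)"
    unfolding \<pi>_eq using DERIV_cdivide[OF m_deriv[OF assms], of Z] by simp
  ultimately show ?thesis
    unfolding r_def
    by (auto intro!: derivative_eq_intros P_deriv[OF assms] simp: field_simps power2_eq_square)
qed

text \<open>The integral of \<open>\<pi>\<close> times the generator over the whole interval is a
  multiple of the difference of the fluxes at 1 and at 0, and both vanish.\<close>

lemma generator_link_1:
  assumes f: "f \<in> generator_domain X"
  shows "generator X' (\<Lambda> f) 1 = 0"
  using Q_flux(2)[OF continuous_generator[OF f] flux_deriv[OF f] flux_0[OF f] flux_1[OF f]]
    intertwining[OF f, of 1] by (simp add: link_eq)

text \<open>By intertwining the left side is \<open>Q\<close> of \<open>generator X f\<close> over
  \<open>P\<close>, that is, the flux over \<open>2 * Z * P\<close>; the identity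
  \<open>1 / s = b * m\<close> then produces \<open>r\<close>.\<close>

lemma generator_link:
  assumes f: "f \<in> generator_domain X" and x: "x \<in> {0<..<1}"
  shows "generator X' (\<Lambda> f) x = 1/2 * b x * r x * deriv f x"
proof -
  have "generator X' (\<Lambda> f) x = deriv f x / s x / (2 * Z) / P x"
    using Q_flux(1)[OF continuous_generator[OF f] flux_deriv[OF f] flux_0[OF f] x]
      intertwining[OF f, of x] x by (simp add: link_eq)
  then show ?thesis
    using b_pos[OF x] by (simp add: r_def \<pi>_eq speed_density_def)
qed

lemma link_derivs:
  assumes f: "f \<in> generator_domain X" and x: "x \<in> {0<..<1}"
  shows "deriv (\<Lambda> f) x = r x * (f x - \<Lambda> f x)"
    and "deriv (deriv (\<Lambda> f)) x = r x * (\<rho> x - 2 * r x) * (f x - \<Lambda> f x) + r x * deriv f x"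
proof -
  have 1: "deriv (\<Lambda> f) y = r y * (f y - \<Lambda> f y)" if "y \<in> {0<..<1}" for y
    using DERIV_imp_deriv[OF link_deriv[OF continuous_domain[OF f] that]] by (simp add: r_def)
  then show "deriv (\<Lambda> f) x = r x * (f x - \<Lambda> f x)"
    using x .
  have "(\<Lambda> f has_real_derivative r x * (f x - \<Lambda> f x)) (at x)"
    using link_deriv[OF continuous_domain[OF f] x] by (simp add: r_def)
  then have "((\<lambda>y. r y * (f y - \<Lambda> f y)) has_real_derivative
      r x * (\<rho> x - 2 * r x) * (f x - \<Lambda> f x) + r x * deriv f x) (at x)"
    by (auto intro!: derivative_eq_intros r_deriv[OF x] domain_deriv[OF f x] simp: algebra_simps)
  then have "(deriv (\<Lambda> f) has_real_derivative
      r x * (\<rho> x - 2 * r x) * (f x - \<Lambda> f x) + r x * deriv f x) (at x)"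
    by (rule has_field_derivative_transform_within_open[where S = "{0<..<1}"]) (use x 1 in auto)
  then show "deriv (deriv (\<Lambda> f)) x = r x * (\<rho> x - 2 * r x) * (f x - \<Lambda> f x) + r x * deriv f x"
    by (rule DERIV_imp_deriv)
qed

text \<open>Both sides of the intertwining are expressed through \<open>f'\<close> and
  \<open>f - \<Lambda> f\<close>; every term carries the positive factor \<open>r\<close>, which
  cancels.\<close>

lemma coefficient_relation:
  assumes f: "f \<in> generator_domain X" and x: "x \<in> {0<..<1}"
  shows "1/2 * (b' x - b x) * deriv f x + \<beta> x * (f x - \<Lambda> f x) = 0"
proof -
  have "1/2 * b x * r x * deriv f x = 1/2 * b' x * deriv (deriv (\<Lambda> f)) x + a' x * deriv (\<Lambda> f) x"
    using D.generator_eq[OF link_domain[OF f] x] generator_link[OF f x] by simp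
  then have "r x * (1/2 * (b' x - b x) * deriv f x + \<beta> x * (f x - \<Lambda> f x)) = 0"
    unfolding link_derivs[OF f x] \<beta>_def by algebra
  then show ?thesis
    using r_pos[OF x] by simp
qed

lemma continuous_\<beta>: "continuous_on {0<..<1} \<beta>"
proof -
  have "continuous_on {0<..<1} r"
    using r_deriv by (intro DERIV_continuous_on) (blast intro: has_field_derivative_at_within)
  moreover have "continuous_on {0<..<1} \<rho>"
    unfolding \<rho>_def using b_pos
    by (intro continuous_intros a b C1_differentiable_on_continuous_deriv[OF b_C1]) (metis less_irrefl)+
  ultimately show ?thesis
    unfolding \<beta>_def by (intro continuous_intros D.a D.b)
qed

text \<open>
  Where \<open>b' \<noteq> b\<close>, the relation above bounds \<open>f'\<close> by a multiple of the supremum norm of \<open>f\<close>,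
  uniformly over the domain of the generator; a dense set of functions cannot satisfy this.
\<close>

lemma diffusion_coefficient_eq:
  assumes v: "v \<in> {0<..<1}"
  shows "b' v = b v"
proof (rule ccontr)
  assume neq: "b' v \<noteq> b v"
  \<comment> \<open>Near \<open>v\<close> the relation reads
    \<open>f' = - \<gamma> * (f - \<Lambda> f)\<close>, with a factor that is bounded there.\<close>
  define \<gamma> where "\<gamma> x = \<beta> x / (1/2 * (b' x - b x))" for x
  have cont: "isCont b v" "isCont b' v" "isCont \<beta> v"
    using b D.b continuous_\<beta> v by (auto simp: continuous_on_eq_continuous_at)
  then have "isCont \<gamma> v"
    unfolding \<gamma>_def using neq by (intro continuous_intros) auto
  then have "\<forall>\<^sub>F x in at v. dist (\<gamma> x) (\<gamma> v) < 1"
    unfolding isCont_def by (rule tendstoD) simp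
  moreover have "isCont (\<lambda>x. b' x - b x) v"
    by (intro continuous_intros cont)
  then have "\<forall>\<^sub>F x in at v. b' x - b x \<noteq> 0"
    unfolding isCont_def using neq by (intro tendsto_imp_eventually_ne) auto
  ultimately have "\<forall>\<^sub>F x in at v. b' x \<noteq> b x \<and> \<bar>\<gamma> x\<bar> \<le> \<bar>\<gamma> v\<bar> + 1"
    by eventually_elim (auto simp: dist_real_def)
  then obtain \<delta> where \<delta>: "\<delta> > 0"
    "\<And>x. x \<noteq> v \<Longrightarrow> dist x v < \<delta> \<Longrightarrow> b' x \<noteq> b x \<and> \<bar>\<gamma> x\<bar> \<le> \<bar>\<gamma> v\<bar> + 1"
    by (auto simp: eventually_at)
  define K where "K = \<bar>\<gamma> v\<bar> + 1"
  have K: "K \<ge> 1" by (simp add: K_def)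
  \<comment> \<open>So short that a slope of at most \<open>5/2 * K\<close> cannot raise
    \<open>f\<close> by \<open>1/2\<close> over this length; \<open>\<eta> < v\<close> keeps
    \<open>v - \<eta>\<close> inside the open interval.\<close>
  define \<eta> where "\<eta> = min (min \<delta> v) (1 / (8 * K)) / 2"
  have \<eta>: "\<eta> > 0" "\<eta> < \<delta>" "\<eta> < v" and \<eta>K: "\<eta> * K \<le> 1 / 16"
  proof -
    show "\<eta> > 0" "\<eta> < \<delta>" "\<eta> < v"
      using \<delta>(1) v K by (auto simp: \<eta>_def)
    have "\<eta> \<le> 1 / (16 * K)"
      using K by (simp add: \<eta>_def field_simps min_def)
    then show "\<eta> * K \<le> 1 / 16"
      using K by (simp add: field_simps)
  qed
  \<comment> \<open>A ramp from 0 at \<open>v - \<eta>\<close> to 1 at \<open>v\<close>. A function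
    within \<open>1/4\<close> of it has norm at most \<open>5/4\<close> and rises by at least
    \<open>1/2\<close> between these points.\<close>
  let ?\<phi> = "\<lambda>y. min 1 (max 0 ((y - (v - \<eta>)) / \<eta>))"
  have "continuous_on {0..1} ?\<phi>"
    using \<eta>(1) by (intro continuous_intros) auto
  then obtain f where f: "f \<in> generator_domain X" "\<And>x. x \<in> {0..1} \<Longrightarrow> \<bar>f x - ?\<phi> x\<bar> \<le> 1/4"
    using generator_domain_dense[of ?\<phi> "1/4"] by (metis zero_less_divide_1_iff zero_less_numeral)
  have f_le: "\<bar>f y\<bar> \<le> 5/4" if "y \<in> {0..1}" for y
  proof -
    have "0 \<le> ?\<phi> y" "?\<phi> y \<le> 1" by simp_all
    then show ?thesis
      using f(2)[OF that] unfolding abs_le_iff by linarith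
  qed
  \<comment> \<open>The mean value theorem gives \<open>z\<close> strictly below \<open>v\<close>,
    so the bound on \<open>\<gamma>\<close>, recorded in \<open>\<delta>\<close> only off
    \<open>v\<close>, applies.\<close>
  have "\<exists>z>v - \<eta>. z < v \<and> f v - f (v - \<eta>) = (v - (v - \<eta>)) * deriv f z"
    using \<eta> v by (intro MVT2) (auto intro!: domain_deriv[OF f(1)])
  then obtain z where z: "v - \<eta> < z" "z < v" "f v - f (v - \<eta>) = \<eta> * deriv f z"
    by auto
  then have z01: "z \<in> {0<..<1}"
    using \<eta> v by auto
  have "b' z \<noteq> b z" and \<gamma>z: "\<bar>\<gamma> z\<bar> \<le> K"
    using \<delta>(2)[of z] z \<eta>(2) by (auto simp: K_def dist_real_def)
  then have "deriv f z = - \<gamma> z * (f z - \<Lambda> f z)"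
    using coefficient_relation[OF f(1) z01] by (simp add: \<gamma>_def field_simps)
  then have "\<bar>deriv f z\<bar> = \<bar>\<gamma> z\<bar> * \<bar>f z - \<Lambda> f z\<bar>"
    by (simp add: abs_mult)
  also have "\<dots> \<le> K * (5/2)"
  proof (rule mult_mono[OF \<gamma>z])
    show "\<bar>f z - \<Lambda> f z\<bar> \<le> 5/2"
      using f_le[of z] link_abs_le[OF continuous_domain[OF f(1)] _ f_le, of z] z01
        abs_triangle_ineq4[of "f z" "\<Lambda> f z"] by simp
  qed (use K in auto)
  finally have "\<eta> * deriv f z \<le> \<eta> * (K * (5/2))"
    using \<eta>(1) by (intro mult_left_mono) auto
  also have "\<dots> = 5/2 * (\<eta> * K)" by simp
  also have "\<dots> < 1/2"
    using \<eta>K by linarith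
  finally have "f v - f (v - \<eta>) < 1/2"
    using z(3) by simp
  moreover have "\<bar>f v - 1\<bar> \<le> 1/4" "\<bar>f (v - \<eta>)\<bar> \<le> 1/4"
    using f(2)[of v] f(2)[of "v - \<eta>"] \<eta> v by simp_all
  then have "f v \<ge> 3/4" "f (v - \<eta>) \<le> 1/4"
    by linarith+
  ultimately show False by simp
qed

text \<open>With equal diffusion coefficients the relation shrinks to
  \<open>\<beta> x * (f x - \<Lambda> f x) = 0\<close>, and an \<open>f\<close> close to
  \<open>P\<close> has a positive second factor. Solving \<open>\<beta> x = 0\<close> gives the
  drift.\<close>

lemma drift_coefficient_eq:
  assumes x: "x \<in> {0<..<1}"
  shows "a' x = 1/2 * deriv b x - a x + b x * r x"
proof -
  have Px: "P x > 0" by (rule P_pos'[OF x])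
  \<comment> \<open>Accuracy \<open>P x / 8\<close> costs at most \<open>P x / 4\<close> of the
    value \<open>P x / 2\<close> that \<open>P - \<Lambda> P\<close> has at
    \<open>x\<close>.\<close>
  obtain f where f: "f \<in> generator_domain X" "\<And>y. y \<in> {0..1} \<Longrightarrow> \<bar>f y - P y\<bar> \<le> P x / 8"
    using generator_domain_dense[OF continuous_P, of "P x / 8"] Px by auto
  have "\<Lambda> f x - \<Lambda> P x \<le> P x / 8"
    using x abs_le_D1[OF f(2)] by (intro link_diff_le continuous_domain[OF f(1)] continuous_P) auto
  moreover have "P x - f x \<le> P x / 8"
    using f(2)[of x] x unfolding abs_le_iff by auto
  ultimately have "f x - \<Lambda> f x > 0"
    using link_P[of x] x Px by auto
  then have "\<beta> x = 0"
    using coefficient_relation[OF f(1) x] diffusion_coefficient_eq[OF x] by simp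
  then have "a' x = b x * r x - 1/2 * (b x * \<rho> x)"
    by (simp add: \<beta>_def diffusion_coefficient_eq[OF x] algebra_simps)
  moreover have "b x * \<rho> x = 2 * a x - deriv b x"
    using b_pos[OF x] by (simp add: \<rho>_def field_simps)
  ultimately show ?thesis
    by (simp add: diff_divide_distrib)
qed

section \<open>Boundary behaviour of the dual\<close>

text \<open>Chosen so that \<open>C * m / P^2\<close> equals 1 at \<open>c\<close>, as the dual
  scale density does.\<close>

definition C :: real where "C = (P c)\<^sup>2 / m c"

lemma C_pos: "C > 0"
  unfolding C_def using P_pos'[OF c] m_pos[OF c] by simp

text \<open>The logarithmic derivative \<open>- 2 * a' / b' = \<rho> - 2 * r\<close> is also that of
  \<open>m / P^2\<close>, so the quotient is constant and its value is read off at
  \<open>c\<close>.\<close>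

lemma dual_scale_density:
  assumes x: "x \<in> {0<..<1}"
  shows "D.s x = C * m x / (P x)\<^sup>2"
proof -
  have "\<exists>k. \<forall>x\<in>{0<..<1}. D.s x * (P x)\<^sup>2 / m x = k"
  proof (rule has_field_derivative_zero_constant)
    fix x :: real
    assume x: "x \<in> {0<..<1}"
    have nz: "m x \<noteq> 0" "P x \<noteq> 0" "b x \<noteq> 0"
      using m_pos[OF x] P_pos'[OF x] b_pos[OF x] by auto
    have \<rho>: "2 * a' x / b' x = 2 * r x - \<rho> x"
      using nz by (simp add: drift_coefficient_eq[OF x] diffusion_coefficient_eq[OF x] \<rho>_def field_simps)
    have "(D.s has_real_derivative - (2 * r x - \<rho> x) * D.s x) (at x)"
      using D.s_deriv[OF x] \<rho> by simp
    then have "((\<lambda>x. D.s x * (P x)\<^sup>2 / m x) has_real_derivative 0) (at x)"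
      using nz by (auto intro!: derivative_eq_intros P_deriv[OF x] m_deriv[OF x]
        simp: r_def field_simps power2_eq_square)
    then show "((\<lambda>x. D.s x * (P x)\<^sup>2 / m x) has_real_derivative 0) (at x within {0<..<1})"
      by (rule has_field_derivative_at_within)
  qed simp
  then have "D.s x * (P x)\<^sup>2 / m x = D.s c * (P c)\<^sup>2 / m c"
    using x c by metis
  moreover have "D.s c = 1"
    by (simp add: scale_density_def)
  ultimately have "D.s x * (P x)\<^sup>2 / m x = C"
    by (simp add: C_def)
  then have "D.s x * (P x)\<^sup>2 = C * m x"
    using m_pos[OF x] by (simp add: nonzero_divide_eq_eq)
  then show ?thesis
    using P_pos'[OF x] by (simp add: nonzero_eq_divide_eq)
qed

lemma dual_speed_density:
  assumes x: "x \<in> {0<..<1}"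
  shows "D.m x = s x * (P x)\<^sup>2 / C"
  using m_pos[OF x] P_pos'[OF x] b_pos[OF x] s_pos[of x]
  by (simp add: speed_density_def[of c a' b'] dual_scale_density[OF x] diffusion_coefficient_eq[OF x]
      speed_density_def[of c a b])

lemma dual_speed_density_le: "x \<in> {0<..<1} \<Longrightarrow> D.m x \<le> s x / C"
  using P_bounds[of x] s_pos[of x] C_pos
  by (auto simp: dual_speed_density intro!: divide_right_mono mult_left_le power_le_one)

text \<open>\<open>1 / P\<close> has derivative \<open>- \<pi> / P^2\<close> with
  \<open>\<pi> = m / Z\<close>, so \<open>- C * Z / P\<close> is a primitive of the dual scale
  density.\<close>

lemma dual_scale_fun:
  assumes x: "x \<in> {0<..<1}" and y: "y \<in> {0<..<1}"
  shows "D.S x - D.S y = C * Z * (1 / P y - 1 / P x)"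
proof -
  have "\<exists>k. \<forall>x\<in>{0<..<1}. D.S x + C * Z / P x = k"
  proof (rule has_field_derivative_zero_constant)
    fix x :: real
    assume x: "x \<in> {0<..<1}"
    have "P x \<noteq> 0" "Z \<noteq> 0"
      using P_pos'[OF x] Z_pos by auto
    then have "((\<lambda>x. D.S x + C * Z / P x) has_real_derivative 0) (at x)"
      by (auto intro!: derivative_eq_intros P_deriv[OF x] D.S_deriv[OF x]
        simp: dual_scale_density[OF x] \<pi>_eq field_simps power2_eq_square)
    then show "((\<lambda>x. D.S x + C * Z / P x) has_real_derivative 0) (at x within {0<..<1})"
      by (rule has_field_derivative_at_within)
  qed simp
  then have "D.S x + C * Z / P x = D.S y + C * Z / P y"
    using x y by metis
  then show ?thesis
    by (simp add: algebra_simps)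
qed

section \<open>Boundary classification for the dual\<close>

lemma dual_m_int: "set_integrable lborel {0<..<1} D.m"
proof (rule set_integrable_bound)
  show "set_integrable lborel {0<..<1} (\<lambda>x. s x / C)"
    using s_int by simp
  show "set_borel_measurable lborel {0<..<1} D.m"
    using continuous_on_indicator_measurable[OF D.continuous_m order.refl]
    by (simp add: set_borel_measurable_def)
  show "AE x in lborel. x \<in> {0<..<1} \<longrightarrow> norm (D.m x) \<le> norm (s x / C)"
      proof (intro AE_I2 impI)
    fix x :: real
    assume "x \<in> {0<..<1}"
    then show "norm (D.m x) \<le> norm (s x / C)"
      using dual_speed_density_le[of x] D.m_pos[of x] unfolding real_norm_def by linarith
  qed
qed

lemma dual_s_le:
  assumes "x \<in> {c..<1}"
  shows "D.s x \<le> C / (P c)\<^sup>2 * m x"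
proof -
  have x: "x \<in> {0<..<1}" using assms c by auto
  have "(P c)\<^sup>2 \<le> (P x)\<^sup>2"
    using P_mono[of c x] P_pos'[OF c] c assms by (intro power_mono) auto
  then have "C * m x / (P x)\<^sup>2 \<le> C * m x / (P c)\<^sup>2"
    using C_pos m_pos[OF x] P_pos'[OF x] P_pos'[OF c] by (intro divide_left_mono) auto
  then show ?thesis
    by (simp add: dual_scale_density[OF x])
qed

text \<open>The factor \<open>P^2\<close> of the dual speed density outweighs the singularity
  \<open>1 / P\<close> of the dual scale function: the integrand is at most
  \<open>Z * s\<close>.\<close>

lemma dual_N0: "N0 c a' b' < \<infinity>"
  unfolding N0_def speed_measure_def
proof (rule weight_finite[where h = "\<lambda>x. Z * s x"])
  show "set_integrable lborel {0<..c} (\<lambda>x. Z * s x)"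
    using c by (intro set_integrable_mult_right set_integrable_subset[OF s_int]) auto
  fix \<eta>
  assume "\<eta> \<in> {0<..c}"
  then have \<eta>: "\<eta> \<in> {0<..<1}" using c by auto
  have pos: "P \<eta> > 0" "P c > 0" "s \<eta> > 0" "C > 0" "Z > 0"
    using P_pos'[OF \<eta>] P_pos'[OF c] s_pos C_pos Z_pos by auto
  show "0 \<le> D.m \<eta>" using D.m_pos[OF \<eta>] by simp
  have "D.m \<eta> * (D.S c - D.S \<eta>) = Z * s \<eta> * (P \<eta> - (P \<eta>)\<^sup>2 / P c)"
    unfolding dual_scale_fun[OF c \<eta>] dual_speed_density[OF \<eta>]
    using pos by (simp add: field_simps power2_eq_square)
  also have "\<dots> \<le> Z * s \<eta> * 1"
    using pos P_bounds[of \<eta>] \<eta> by (intro mult_left_mono) (auto intro: order_trans[of _ "P \<eta>"])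
  finally show "D.m \<eta> * (D.S c - D.S \<eta>) \<le> Z * s \<eta>" by simp
qed (use c in \<open>auto intro!: continuous_intros D.continuous_m D.continuous_S\<close>)

text \<open>Up to a constant \<open>D.S\<close> is \<open>- C * Z / P\<close>, unbounded at 0. A
  finite value would make \<open>D.s\<close> integrable, hence \<open>D.S\<close> bounded and
  \<open>P\<close> bounded away from 0, against \<open>P 0 = 0\<close>.\<close>

lemma dual_Sigma0: "Sigma0 c a' b' = \<infinity>"
proof (rule ccontr)
  assume "Sigma0 c a' b' \<noteq> \<infinity>"
  then have 0: "set_integrable lborel {0<..<c/2} D.s"
    by (intro D.s_integrable_0) (simp add: less_top)
  have sub: "{c<..<1} \<subseteq> {0<..<1}"
    using c by auto
  have 1: "set_integrable lborel {c<..<1} D.s"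
  proof (rule set_integrable_bound)
    show "set_integrable lborel {c<..<1} (\<lambda>x. C / (P c)\<^sup>2 * m x)"
      by (intro set_integrable_mult_right set_integrable_subset[OF m_int _ sub]) auto
    show "set_borel_measurable lborel {c<..<1} D.s"
      using continuous_on_indicator_measurable[OF D.continuous_s sub]
      by (simp add: set_borel_measurable_def)
    show "AE x in lborel. x \<in> {c<..<1} \<longrightarrow> norm (D.s x) \<le> norm (C / (P c)\<^sup>2 * m x)"
    proof (intro AE_I2 impI)
      fix x :: real
      assume "x \<in> {c<..<1}"
      then have "D.s x \<le> C / (P c)\<^sup>2 * m x"
        by (intro dual_s_le) auto
      then show "norm (D.s x) \<le> norm (C / (P c)\<^sup>2 * m x)"
        using D.s_pos[of x] by (simp only: real_norm_def)
    qed
  qed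
  have "c / 2 \<in> {0<..<1}" using c by auto
  from set_integrable_interior[OF D.continuous_s this c 0 1]
  have "set_integrable lborel {0<..<1} D.s" .
  from antiderivative_bounded[OF D.continuous_s this D.S_deriv]
  obtain K where K: "\<And>x. x \<in> {0<..<1} \<Longrightarrow> \<bar>D.S x\<bar> \<le> K" by blast
  \<comment> \<open>Solves \<open>dual_scale_fun\<close> for \<open>C * Z / P x\<close> and bounds
    both values of \<open>D.S\<close> by \<open>K\<close>.\<close>
  define B where "B = 2 * K + C * Z / P c"
  have le: "C * Z / P x \<le> B" if "x \<in> {0<..<1}" for x
    using dual_scale_fun[OF c that] K[OF that] K[OF c] by (simp add: B_def algebra_simps abs_le_iff)
  have CZ: "C * Z > 0" using C_pos Z_pos by simp
  then have "B > 0"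
    using le[OF c] P_pos'[OF c] by (meson divide_pos_pos less_le_trans)
  have low: "C * Z / B \<le> P x" if "x \<in> {0<..<1}" for x
    using le[OF that] P_pos'[OF that] \<open>B > 0\<close> by (simp add: field_simps)
  have "(P \<longlongrightarrow> P 0) (at_right 0)"
    by (rule continuous_on_Icc_at_rightD[OF continuous_P]) simp
  moreover have "\<forall>\<^sub>F x in at_right 0. C * Z / B \<le> P x"
    using eventually_at_right_real[of 0 1] low by (auto elim!: eventually_mono)
  ultimately have "C * Z / B \<le> P 0"
    by (intro tendsto_lowerbound) auto
  then show False
    using CZ \<open>B > 0\<close> P_0 by (simp add: divide_le_0_iff)
qed

text \<open>On \<open>{c..<1}\<close> the values of \<open>P\<close> stay between \<open>P c\<close>
  and 1, so the integrand is \<open>Z / P c * s\<close> times a factor of at most 1.\<close>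

lemma dual_N1: "N1 c a' b' < \<infinity>"
  unfolding N1_def speed_measure_def
proof (rule weight_finite[where h = "\<lambda>x. Z / P c * s x"])
  show "set_integrable lborel {c..<1} (\<lambda>x. Z / P c * s x)"
    using c by (intro set_integrable_mult_right set_integrable_subset[OF s_int]) auto
  fix \<eta>
  assume "\<eta> \<in> {c..<1}"
  then have \<eta>: "\<eta> \<in> {0<..<1}" using c by auto
  have pos: "P \<eta> > 0" "P c > 0" "s \<eta> > 0" "C > 0" "Z > 0"
    using P_pos'[OF \<eta>] P_pos'[OF c] s_pos C_pos Z_pos by auto
  show "0 \<le> D.m \<eta>" using D.m_pos[OF \<eta>] by simp
  have "D.m \<eta> * (D.S \<eta> - D.S c) = Z / P c * s \<eta> * ((P \<eta>)\<^sup>2 - P \<eta> * P c)"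
    unfolding dual_scale_fun[OF \<eta> c] dual_speed_density[OF \<eta>]
    using pos by (simp add: field_simps power2_eq_square)
  also have "\<dots> \<le> Z / P c * s \<eta> * 1"
  proof (rule mult_left_mono)
    have "(P \<eta>)\<^sup>2 \<le> 1"
      using P_bounds[of \<eta>] \<eta> by (intro power_le_one) auto
    then show "(P \<eta>)\<^sup>2 - P \<eta> * P c \<le> 1"
      using mult_pos_pos[OF pos(1,2)] by linarith
  qed (use pos in auto)
  finally show "D.m \<eta> * (D.S \<eta> - D.S c) \<le> Z / P c * s \<eta>" by simp
qed (use c in \<open>auto intro!: continuous_intros D.continuous_m D.continuous_S\<close>)

lemma dual_M_bounded:
  obtains K where "\<And>x. x \<in> {0<..<1} \<Longrightarrow> \<bar>D.M x\<bar> \<le> K"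
  using antiderivative_bounded[OF D.continuous_m dual_m_int D.M_deriv] by blast

text \<open>\<open>D.M\<close> is bounded, and on \<open>{c..<1}\<close> the density
  \<open>D.s\<close> is at most a multiple of the integrable \<open>m\<close>.\<close>

lemma dual_Sigma1: "Sigma1 c a' b' < \<infinity>"
proof -
  obtain K where K: "\<And>x. x \<in> {0<..<1} \<Longrightarrow> \<bar>D.M x\<bar> \<le> K"
    using dual_M_bounded by blast
  show ?thesis
    unfolding Sigma1_def scale_measure_def
  proof (rule weight_finite[where h = "\<lambda>x. C / (P c)\<^sup>2 * (2 * K) * m x"])
    show "set_integrable lborel {c..<1} (\<lambda>x. C / (P c)\<^sup>2 * (2 * K) * m x)"
      using c by (intro set_integrable_mult_right set_integrable_subset[OF m_int]) auto
    fix \<eta>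
    assume c\<eta>: "\<eta> \<in> {c..<1}"
    then have \<eta>: "\<eta> \<in> {0<..<1}" using c by auto
    show "0 \<le> D.s \<eta>" using D.s_pos[of \<eta>] by simp
    have "D.s \<eta> * (D.M \<eta> - D.M c) \<le> (C / (P c)\<^sup>2 * m \<eta>) * (2 * K)"
      using dual_s_le[OF c\<eta>] K[OF \<eta>] K[OF c] D.mono_M[of c \<eta>] c c\<eta> C_pos m_pos[OF \<eta>]
      by (intro mult_mono) (auto simp: abs_le_iff)
    then show "D.s \<eta> * (D.M \<eta> - D.M c) \<le> C / (P c)\<^sup>2 * (2 * K) * m \<eta>"
      by (simp add: mult_ac)
  qed (use c in \<open>auto intro!: continuous_intros D.continuous_s D.continuous_M\<close>)
qed

section \<open>Absorption of the dual at the right boundary\<close>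

text \<open>
  As the boundary \<open>1\<close> is regular, \<open>G' / D.s\<close> stays bounded near \<open>1\<close>, whereas the link of a
  function close to \<open>P\<close> increases there at a rate of the order of \<open>D.s\<close>. Adding a large multiple of
  it moves the maximum of \<open>G\<close> to \<open>1\<close> without changing the value of the generator at \<open>1\<close>.
\<close>

lemma generator_1_nonpos:
  assumes G: "G \<in> generator_domain X'"
  shows "generator X' G 1 \<le> 0"
proof -
  \<comment> \<open>The interval is split at \<open>1/2\<close>: on the left half the link of
    \<open>f\<close> has to stay well below its value at 1, on the right half it has to increase
    fast enough.\<close>
  define p where "p = P (1/2)"
  have p: "0 < p" "p < 1"
    using P_less[of 0 "1/2"] P_less[of "1/2" 1] P_0 P_1 by (auto simp: p_def)
  \<comment> \<open>Replacing \<open>P\<close> by \<open>f\<close> costs at most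
    \<open>2 * e\<close> in either estimate, which leaves at least \<open>(1 - p) / 4\<close> of the
    gap \<open>(1 - p) / 2\<close> and \<open>p / 4\<close> of the slope
    \<open>p / 2\<close>.\<close>
  define e where "e = min p (1 - p) / 16"
  have e: "e > 0" "e \<le> p / 16" "e \<le> (1 - p) / 16"
    using p by (auto simp: e_def)
  obtain f where f: "f \<in> generator_domain X" and fP: "\<And>x. x \<in> {0..1} \<Longrightarrow> \<bar>f x - P x\<bar> \<le> e"
    using generator_domain_dense[OF continuous_P e(1)] by blast
  have \<Lambda>f: "\<Lambda> f x \<le> P x / 2 + e" "P x / 2 - e \<le> \<Lambda> f x" if "x \<in> {0..1}" for x
  proof -
    have "\<Lambda> f x - \<Lambda> P x \<le> e" "\<Lambda> P x - \<Lambda> f x \<le> e"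
      using fP by (auto intro!: link_diff_le continuous_domain[OF f] continuous_P that simp: abs_le_iff)
    then show "\<Lambda> f x \<le> P x / 2 + e" "P x / 2 - e \<le> \<Lambda> f x"
      using link_P[OF that] by auto
  qed
  have gap: "(1 - p) / 4 \<le> \<Lambda> f 1 - \<Lambda> f x" if "x \<in> {0..1/2}" for x
  proof -
    have "P x \<le> p"
      using P_mono[of x "1/2"] that by (simp add: p_def)
    then show ?thesis
      using \<Lambda>f(1)[of x] \<Lambda>f(2)[of 1] that e P_1 by simp
  qed
  have slope: "p / 4 \<le> f x - \<Lambda> f x" and Pp: "p \<le> P x" if "x \<in> {1/2<..<1}" for x
  proof -
    show "p \<le> P x"
      using P_mono[of "1/2" x] that by (simp add: p_def)
    then show "p / 4 \<le> f x - \<Lambda> f x"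
      using \<Lambda>f(1)[of x] fP[of x] that e by (simp add: abs_le_iff)
  qed
  obtain K1 where K1: "\<And>x. x \<in> {0..1} \<Longrightarrow> \<bar>generator X' G x\<bar> \<le> K1"
    using continuous_on_Icc_bound[OF D.continuous_generator[OF G]] by blast
  obtain K2 where K2: "\<And>x. x \<in> {0..1} \<Longrightarrow> \<bar>G x\<bar> \<le> K2"
    using continuous_on_Icc_bound[OF D.continuous_domain[OF G]] by blast
  obtain K3 where K3: "\<And>x. x \<in> {0<..<1} \<Longrightarrow> \<bar>D.M x\<bar> \<le> K3"
    using dual_M_bounded by blast
  define H where "H x = deriv G x / D.s x" for x
  have H_deriv: "(H has_real_derivative 2 * D.m x * generator X' G x) (at x)" if "x \<in> {0<..<1}" for x
    unfolding H_def by (rule D.flux_deriv[OF G that])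
  have K1_nonneg: "K1 \<ge> 0" using K1[of 0] by simp
  have K3_nonneg: "K3 \<ge> 0" using K3[OF c] by simp
  \<comment> \<open>The flux \<open>H\<close> has derivative at least \<open>- 2 * K1 * D.m\<close>,
    so adding \<open>2 * K1 * D.M\<close> makes it nondecreasing; increments of \<open>D.M\<close>
    are at most \<open>2 * K3\<close>.\<close>
  define L where "L = \<bar>H (1/2)\<bar> + 4 * K1 * K3"
  have L: "L \<ge> 0" using K1_nonneg K3_nonneg by (simp add: L_def)
  have H_ge: "- L \<le> H x" if x: "x \<in> {1/2<..<1}" for x
  proof -
    have "H (1/2) + 2 * K1 * D.M (1/2) \<le> H x + 2 * K1 * D.M x"
    proof (rule DERIV_nonneg_imp_nondecreasing[where f = "\<lambda>x. H x + 2 * K1 * D.M x"])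
      fix y :: real
      assume "1/2 \<le> y" "y \<le> x"
      then have y: "y \<in> {0<..<1}" using x by auto
      have "((\<lambda>x. H x + 2 * K1 * D.M x) has_real_derivative 2 * D.m y * (generator X' G y + K1)) (at y)"
        by (auto intro!: derivative_eq_intros H_deriv[OF y] D.M_deriv[OF y] simp: algebra_simps)
      moreover have "0 \<le> 2 * D.m y * (generator X' G y + K1)"
        using K1[of y] y D.m_pos[OF y] by (simp add: abs_le_iff)
      ultimately show "\<exists>d. ((\<lambda>x. H x + 2 * K1 * D.M x) has_real_derivative d) (at y) \<and> 0 \<le> d"
        by blast
    qed (use x in simp)
    moreover have "2 * K1 * D.M x - 2 * K1 * D.M (1/2) \<le> 4 * K1 * K3"
    proof -
      have "D.M x - D.M (1/2) \<le> 2 * K3"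
        using K3[of x] K3[of "1/2"] x by (simp add: abs_le_iff)
      then have "2 * K1 * (D.M x - D.M (1/2)) \<le> 2 * K1 * (2 * K3)"
        using K1_nonneg by (intro mult_left_mono) auto
      then show ?thesis by (simp add: algebra_simps)
    qed
    ultimately show ?thesis
      by (simp add: L_def)
  qed
  \<comment> \<open>The first bound lets the slope of \<open>k * \<Lambda> f\<close> beat any
    decrease of \<open>G\<close> on the right half; the second lets its gap beat the oscillation
    \<open>2 * K2\<close> of \<open>G\<close> on the left half.\<close>
  define k where "k = max (4 * Z * L * C / p\<^sup>2) (8 * K2 / (1 - p))"
  have k1: "L * C / p \<le> k * p / (4 * Z)"
  proof -
    have "4 * Z * L * C / p\<^sup>2 \<le> k" by (simp add: k_def)
    then have "4 * Z * L * C / p\<^sup>2 * (p / (4 * Z)) \<le> k * (p / (4 * Z))"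
      using p Z_pos by (intro mult_right_mono) auto
    then show ?thesis
      using p Z_pos by (simp add: power2_eq_square)
  qed
  have k2: "2 * K2 \<le> k * ((1 - p) / 4)"
  proof -
    have "8 * K2 / (1 - p) \<le> k" by (simp add: k_def)
    then have "8 * K2 / (1 - p) * ((1 - p) / 4) \<le> k * ((1 - p) / 4)"
      using p by (intro mult_right_mono) auto
    then show ?thesis
      using p by simp
  qed
  have k: "k \<ge> 0"
    using p Z_pos L C_pos by (simp add: k_def le_max_iff_disj)
  let ?W = "\<lambda>y. 1 * G y + k * \<Lambda> f y"
  have W: "?W \<in> generator_domain X'"
    by (rule D.domain_linear[OF G link_domain[OF f]])
  have "?W y \<le> ?W 1" if y: "y \<in> {0..1}" for y
  proof (cases "y \<le> 1/2")
    case True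
    have "k * ((1 - p) / 4) \<le> k * (\<Lambda> f 1 - \<Lambda> f y)"
      using gap[of y] True y k by (intro mult_left_mono) auto
    then show ?thesis
      using k2 K2[OF y] abs_le_D2[OF K2[of 1]] unfolding right_diff_distrib abs_le_iff by simp
  next
    case False
    show ?thesis
    proof (rule DERIV_nonneg_imp_increasing_open[where f = ?W])
      fix x :: real
      assume "y < x" "x < 1"
      then have xh: "x \<in> {1/2<..<1}" and x: "x \<in> {0<..<1}" using False by auto
      let ?d = "deriv G x + k * (r x * (f x - \<Lambda> f x))"
      have "(\<Lambda> f has_real_derivative r x * (f x - \<Lambda> f x)) (at x)"
        using link_deriv[OF continuous_domain[OF f] x] by (simp add: r_def)
      then have "(?W has_real_derivative ?d) (at x)"
        by (auto intro!: derivative_eq_intros D.domain_deriv[OF G x])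
      moreover have "0 \<le> ?d"
      proof -
        note pos = m_pos[OF x] P_pos'[OF x] Z_pos r_pos[OF x] D.s_pos[of x] C_pos
        have "k * (r x * (p / 4)) \<le> k * (r x * (f x - \<Lambda> f x))"
          using k pos slope[OF xh] by (intro mult_left_mono) auto
        moreover have "- L * D.s x \<le> deriv G x"
          using H_ge[OF xh] pos by (simp add: H_def field_simps)
        moreover have "L * D.s x \<le> k * (r x * (p / 4))"
        proof -
          \<comment> \<open>\<open>D.s\<close> is \<open>C * m / P^2\<close> while \<open>r\<close>
            is \<open>m / (Z * P)\<close>; the additional factor \<open>1 / P\<close> is at most
            \<open>1 / p\<close> on the right half.\<close>
          have "L * D.s x = m x / P x * (L * C / P x)"
            using pos by (simp add: dual_scale_density[OF x] power2_eq_square)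
          also have "\<dots> \<le> m x / P x * (L * C / p)"
            using pos L p Pp[OF xh] by (intro mult_left_mono divide_left_mono) auto
          also have "\<dots> \<le> m x / P x * (k * p / (4 * Z))"
            using pos k1 by (intro mult_left_mono) auto
          also have "\<dots> = k * (r x * (p / 4))"
            by (simp add: r_def \<pi>_eq mult_ac)
          finally show ?thesis .
        qed
        ultimately show ?thesis by linarith
      qed
      ultimately show "\<exists>d. (?W has_real_derivative d) (at x) \<and> 0 \<le> d"
        by blast
    next
      show "continuous_on {y..1} ?W"
        by (rule continuous_on_subset[OF D.continuous_domain[OF W]]) (use y in auto)
    qed (use y in auto)
  qed
  then have "generator X' ?W 1 \<le> 0"
    by (intro D.positive_maximum_principle W) auto
  then show ?thesis
    using D.generator_add_scaled[OF G link_domain[OF f], of 1 1 k] generator_link_1[OF f] by simp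
qed

text \<open>The one-sided bound is applied to \<open>G\<close> and to \<open>- G\<close>, the latter
  written as a linear combination to fit \<open>domain_linear\<close>.\<close>

lemma dual_absorbing: "absorbing_at 1 X'"
  unfolding absorbing_at_def
proof
  fix G
  assume G: "G \<in> generator_domain X'"
  have "generator X' (\<lambda>y. - 1 * G y + 0 * G y) 1 \<le> 0"
    by (rule generator_1_nonpos[OF D.domain_linear[OF G G]])
  then have "0 \<le> generator X' G 1"
    using D.generator_add_scaled[OF G G, of 1 "- 1" 0] by simp
  then show "generator X' G 1 = 0"
    using generator_1_nonpos[OF G] by simp
qed

end

theorem theorem3p4:
  fixes X :: "'w diffusion" and X' :: "'v diffusion"
    and a b a' b' :: "real \<Rightarrow> real" and c :: real
  assumes "c \<in> {0<..<1}"
    and "diffusion_with_coefficients a b X"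
    and "regular_diffusion X"
    and "reflecting_at_0 c a b X"
    and "reflecting_at_1 c a b X"
    and "b C1_differentiable_on {0<..<1}"
    and "strong_stationary_dual c a b X a' b' X'"
  shows "(\<forall>f\<in>generator_domain X'. \<forall>x\<in>{0<..<1}.
            generator X' f x =
              (1/2 * deriv b x - a x + b x * (stat_density c a b x / stat_cdf c a b x)) * deriv f x
              + 1/2 * b x * deriv (deriv f) x)
         \<and> entrance_at_0 c a' b'
         \<and> regular_at_1 c a' b' \<and> absorbing_at 1 X'"
proof -
  have coeff': "diffusion_with_coefficients a' b' X'"
    using assms(7) by (simp add: strong_stationary_dual_def)
  interpret generated_diffusion c a b X
    using assms(1,2) by unfold_locales (auto simp: diffusion_with_coefficients_def)
  interpret D: generated_diffusion c a' b' X'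
    using assms(1) coeff' by unfold_locales (auto simp: diffusion_with_coefficients_def)
  \<comment> \<open>Regularity of both boundaries makes the scale and the speed measure finite,
    which the facts about the link presuppose.\<close>
  have "set_integrable lborel {0<..<1} s" "set_integrable lborel {0<..<1} m"
    using assms(4,5) integrable_if_regular by (auto simp: reflecting_at_0_def reflecting_at_1_def)
  then interpret dual_pair c a b X a' b' X'
    using assms(4-7)
    by unfold_locales (auto simp: reflecting_at_0_def reflecting_at_1_def strong_stationary_dual_def)
  show ?thesis
  proof (intro conjI ballI)
    fix f and x :: real
    assume f: "f \<in> generator_domain X'" and x: "x \<in> {0<..<1}"
    then show "generator X' f x =
        (1/2 * deriv b x - a x + b x * (stat_density c a b x / stat_cdf c a b x)) * deriv f x
        + 1/2 * b x * deriv (deriv f) x"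
      by (simp add: D.generator_eq diffusion_coefficient_eq drift_coefficient_eq r_def)
  qed (simp_all add: entrance_at_0_def regular_at_1_def dual_Sigma0 dual_absorbing
      dual_N0[unfolded infinity_ennreal_def] dual_N1[unfolded infinity_ennreal_def]
      dual_Sigma1[unfolded infinity_ennreal_def])
qed

end
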